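(* Let $\mathscr G=(X,\mathcal L)$ be an interval greedoid, let $1\le k<\mathrm{rk}(\mathscr G)$, and let $q:\mathcal L\to\mathbb R_{>0}$ be a $k$-admissible weight function. Then $$\mathrm L_q(k)^2\ \ge\ \mathrm L_q(k-1)\cdot\mathrm L_q(k+1),\qquad\text{where } \mathrm L_q(j)=\sum_{\alpha\in\mathcal L,\ |\alpha|=j}q(\alpha).$$
   Context: **Greedoids.** Let $X$ be a finite set, $X^*$ the set of finite words in $X$; a word is simple if no letter repeats; $|\alpha|$ is the length of $\alpha$. A greedoid is a pair $\mathscr G=(X,\mathcal L)$ with $\mathcal L\subset X^*$ finite such that: the empty word is in $\mathcal L$; every $\alpha\in\mathcal L$ is simple; $\alpha\beta\in\mathcal L\Rightarrow\alpha\in\mathcal L$; and if $\alpha,\beta\in\mathcal L$ with $|\alpha|>|\beta|$ then there is a letter $x$ of $\alpha$ with $\beta x\in\mathcal L$. $\mathrm{rk}(\mathscr G)=\max\{|\alpha|:\alpha\in\mathcal L\}$. It is an interval greedoid if moreover for all $\alpha,\beta,\gamma\in X^*$, $x\in X$: $\alpha x,\ \alpha\beta\gamma x\in\mathcal L\Rightarrow\alpha\beta x\in\mathcal L$. **Notation.** For $\alpha\in\mathcal L$: $\mathrm{Cont}_r(\alpha)=\{\beta\in X^*:|\beta|=r,\ \alpha\beta\in\mathcal L\}$, $\mathrm{Cont}(\alpha)=\mathrm{Cont}_1(\alpha)$ (and these sets are empty if $\alpha\notin\mathcal L$). On $\mathrm{Cont}(\alpha)$ the relation $x\sim_\alpha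 y\iff\alpha xy\notin\mathcal L$ is an equivalence relation; $\mathrm{Par}(\alpha)$ is the set of its classes. For $x\in\mathrm{Cont}(\alpha)$, $\mathrm{Des}_\alpha(x)=\{y\in X:\alpha xy\in\mathcal L,\ \alpha y\notin\mathcal L\}$. For $x,y\in X$, $\mathrm{Pas}_\alpha(x,y)=\{z\in X:\alpha z\notin\mathcal L,\ \alpha xz\notin\mathcal L,\ \alpha yz\notin\mathcal L,\ \alpha xyz\in\mathcal L\}$, $\mathrm{Act}_\alpha(x,y)=\{z\in X:\alpha z\notin\mathcal L,\ \alpha xz\in\mathcal L,\ \alpha yz\in\mathcal L,\ \alpha xyz\in\mathcal L\}$. **$k$-admissible.** Let $m=\mathrm{rk}(\mathscr G)$ and $1\le k<m$. Extend $q:\mathcal L\to\mathbb R_{>0}$ to $X^*$ by $0$ outside $\mathcal L$. $q$ is $k$-admissible if there is a scale sequence $(c_0,\dots,c_m)\in\mathbb R_{>0}^{m+1}$ such that, with $\omega(\alpha):=q(\alpha)/c_{|\alpha|}$, the following hold for every $\alpha\in\mathcal L$ with $\ell:=|\alpha|<k$: 1. (ContInv) $q(\alpha xy\beta)=q(\alpha yx\beta)$ for all $x,y\in\mathrm{Cont}(\alpha)$, $\beta\in X^*$. 2. (PAMon) for all distinct $x,y\in\mathrm{Cont}(\alpha)$ and all $r\ge0$: $\sum_{z\in\mathrm{Pas}_\alpha(x,y)}\sum_{\beta\in\mathrm{Cont}_r(\alpha xyz)}q(\alpha xyz\beta)\ \ge\ \sum_{z\in\mathrm{Act}_\alpha(x,y)}\sum_{\beta\in\mathrm{Cont}_r(\alpha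 xyz)}q(\alpha xyz\beta)$. 3. (LogMod) $\omega(\alpha x)\,\omega(\alpha y)=\omega(\alpha)\,\omega(\alpha xy)$ for all $x,y\in\mathrm{Cont}(\alpha)$ with $\alpha xy\in\mathcal L$. 4. (FewDes) for every $\mathcal C\in\mathrm{Par}(\alpha)$ with $|\mathcal C|\ge2$ and every $x\in\mathcal C$: $\mathrm{Des}_\alpha(x)=\varnothing$. 5. (SynMon) $\omega(\alpha x)^2\ge\sum_{y\in\mathrm{Des}_\alpha(x)}\omega(\alpha)\,\omega(\alpha xy)$ for all $x\in\mathrm{Cont}(\alpha)$. 6. (ScaleMon) $\Bigl(1-\frac{c_{\ell+1}^2}{c_\ell c_{\ell+2}}\Bigr)\sum_{\mathcal C\in\mathrm{Par}(\alpha)}\frac{1}{1-b_\alpha(\mathcal C)}\le1$, where $b_\alpha(\mathcal C)=\sum_{y\in\mathrm{Des}_\alpha(x)}\frac{\omega(\alpha)\omega(\alpha xy)}{\omega(\alpha x)^2}$ if $\mathcal C=\{x\}$ and $b_\alpha(\mathcal C)=0$ if $|\mathcal C|\ge2$. Convention: this is considered satisfied whenever $c_{\ell+1}^2\ge c_\ell c_{\ell+2}$; and when $c_{\ell+1}^2<c_\ell c_{\ell+2}$ it includes the requirement $b_\alpha(\mathcal C)<1$ for all $\mathcal C\in\mathrm{Par}(\alpha)$. *)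

theory Defs
  imports Complex_Main
begin

text \<open>Words over \<open>X\<close> are lists in \<^term>\<open>lists X\<close>; a letter \<open>x\<close> is appended as \<open>\<alpha> @ [x]\<close>.\<close>

locale greedoid =
  fixes X :: "'a set" and L :: "'a list set"
  assumes finite_X: "finite X"
    and L_words: "L \<subseteq> lists X"
    and finite_L: "finite L"
    and Nil_in_L: "[] \<in> L"
    and simple: "\<alpha> \<in> L \<Longrightarrow> distinct \<alpha>"
    and hereditary: "\<alpha> @ \<beta> \<in> L \<Longrightarrow> \<alpha> \<in> L"
    and exchange: "\<lbrakk>\<alpha> \<in> L; \<beta> \<in> L; length \<alpha> > length \<beta>\<rbrakk> \<Longrightarrow> \<exists>x\<in>set \<alpha>. \<beta> @ [x] \<in> L"

locale interval_greedoid = greedoid +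
  assumes interval: "\<lbrakk>\<alpha> \<in> lists X; \<beta> \<in> lists X; \<gamma> \<in> lists X; x \<in> X;
      \<alpha> @ [x] \<in> L; \<alpha> @ \<beta> @ \<gamma> @ [x] \<in> L\<rbrakk> \<Longrightarrow> \<alpha> @ \<beta> @ [x] \<in> L"

definition greedoid_rk :: "'a list set \<Rightarrow> nat" where
  "greedoid_rk L = Max (length ` L)"

definition cont_words :: "'a set \<Rightarrow> 'a list set \<Rightarrow> nat \<Rightarrow> 'a list \<Rightarrow> 'a list set" where
  "cont_words X L r \<alpha> = {\<beta> \<in> lists X. \<alpha> \<in> L \<and> length \<beta> = r \<and> \<alpha> @ \<beta> \<in> L}"

text \<open>Continuations of length one, as letters instead of one-letter words.\<close>

definition cont :: "'a set \<Rightarrow> 'a list set \<Rightarrow> 'a list \<Rightarrow> 'a set" where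
  "cont X L \<alpha> = {x. [x] \<in> cont_words X L 1 \<alpha>}"

definition par_rel :: "'a set \<Rightarrow> 'a list set \<Rightarrow> 'a list \<Rightarrow> ('a \<times> 'a) set" where
  "par_rel X L \<alpha> = {(x, y). x \<in> cont X L \<alpha> \<and> y \<in> cont X L \<alpha> \<and> \<alpha> @ [x, y] \<notin> L}"

definition par :: "'a set \<Rightarrow> 'a list set \<Rightarrow> 'a list \<Rightarrow> 'a set set" where
  "par X L \<alpha> = cont X L \<alpha> // par_rel X L \<alpha>"

definition des :: "'a set \<Rightarrow> 'a list set \<Rightarrow> 'a list \<Rightarrow> 'a \<Rightarrow> 'a set" where
  "des X L \<alpha> x = {y \<in> X. \<alpha> @ [x, y] \<in> L \<and> \<alpha> @ [y] \<notin> L}"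

definition pas :: "'a set \<Rightarrow> 'a list set \<Rightarrow> 'a list \<Rightarrow> 'a \<Rightarrow> 'a \<Rightarrow> 'a set" where
  "pas X L \<alpha> x y =
    {z \<in> X. \<alpha> @ [z] \<notin> L \<and> \<alpha> @ [x, z] \<notin> L \<and> \<alpha> @ [y, z] \<notin> L \<and> \<alpha> @ [x, y, z] \<in> L}"

definition act :: "'a set \<Rightarrow> 'a list set \<Rightarrow> 'a list \<Rightarrow> 'a \<Rightarrow> 'a \<Rightarrow> 'a set" where
  "act X L \<alpha> x y =
    {z \<in> X. \<alpha> @ [z] \<notin> L \<and> \<alpha> @ [x, z] \<in> L \<and> \<alpha> @ [y, z] \<in> L \<and> \<alpha> @ [x, y, z] \<in> L}"

lemma (in greedoid) equiv_par_rel: "equiv (cont X L \<alpha>) (par_rel X L \<alpha>)"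
proof (rule equivI)
  have L_D: "\<alpha> @ [x] \<in> L" if "x \<in> cont X L \<alpha>" for x
    using that by (simp add: cont_def cont_words_def)
  have swap: "\<alpha> @ [y, x] \<in> L"
    if "\<alpha> @ [x, y] \<in> L" "\<alpha> @ [y] \<in> L" for x y
    using exchange[OF that] simple[of "\<alpha> @ [y, _]"] by fastforce
  show "par_rel X L \<alpha> \<subseteq> cont X L \<alpha> \<times> cont X L \<alpha>"
    by (auto simp: par_rel_def)
  show "refl_on (cont X L \<alpha>) (par_rel X L \<alpha>)"
    using simple by (fastforce simp: refl_on_def par_rel_def)
  show "sym (par_rel X L \<alpha>)"
    using swap L_D by (fastforce simp: sym_def par_rel_def)
  have "\<alpha> @ [y, x] \<in> L \<or> \<alpha> @ [y, z] \<in> L"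
    if "\<alpha> @ [x, z] \<in> L" "\<alpha> @ [y] \<in> L" for x y z
    using exchange[OF that] simple[of "\<alpha> @ [y, _]"] by fastforce
  then show "trans (par_rel X L \<alpha>)"
    using swap L_D by (fastforce simp: trans_def par_rel_def)
qed

definition zero_ext :: "'a list set \<Rightarrow> ('a list \<Rightarrow> real) \<Rightarrow> 'a list \<Rightarrow> real" where
  "zero_ext L q \<alpha> = (if \<alpha> \<in> L then q \<alpha> else 0)"

definition scaled :: "'a list set \<Rightarrow> ('a list \<Rightarrow> real) \<Rightarrow> (nat \<Rightarrow> real) \<Rightarrow> 'a list \<Rightarrow> real" where
  "scaled L q c \<alpha> = zero_ext L q \<alpha> / c (length \<alpha>)"

definition ContInv :: "'a set \<Rightarrow> 'a list set \<Rightarrow> ('a list \<Rightarrow> real) \<Rightarrow> 'a list \<Rightarrow> bool" where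
  "ContInv X L q \<alpha> \<longleftrightarrow>
    (\<forall>x\<in>cont X L \<alpha>. \<forall>y\<in>cont X L \<alpha>. \<forall>\<beta>\<in>lists X.
      zero_ext L q (\<alpha> @ [x, y] @ \<beta>) = zero_ext L q (\<alpha> @ [y, x] @ \<beta>))"

definition PAMon :: "'a set \<Rightarrow> 'a list set \<Rightarrow> ('a list \<Rightarrow> real) \<Rightarrow> 'a list \<Rightarrow> bool" where
  "PAMon X L q \<alpha> \<longleftrightarrow>
    (\<forall>x\<in>cont X L \<alpha>. \<forall>y\<in>cont X L \<alpha>. x \<noteq> y \<longrightarrow> (\<forall>r.
      (\<Sum>z\<in>pas X L \<alpha> x y. \<Sum>\<beta>\<in>cont_words X L r (\<alpha> @ [x, y, z]). zero_ext L q (\<alpha> @ [x, y, z] @ \<beta>))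
      \<ge> (\<Sum>z\<in>act X L \<alpha> x y. \<Sum>\<beta>\<in>cont_words X L r (\<alpha> @ [x, y, z]). zero_ext L q (\<alpha> @ [x, y, z] @ \<beta>))))"

definition LogMod :: "'a set \<Rightarrow> 'a list set \<Rightarrow> ('a list \<Rightarrow> real) \<Rightarrow> 'a list \<Rightarrow> bool" where
  "LogMod X L \<omega> \<alpha> \<longleftrightarrow>
    (\<forall>x\<in>cont X L \<alpha>. \<forall>y\<in>cont X L \<alpha>. \<alpha> @ [x, y] \<in> L \<longrightarrow>
      \<omega> (\<alpha> @ [x]) * \<omega> (\<alpha> @ [y]) = \<omega> \<alpha> * \<omega> (\<alpha> @ [x, y]))"

definition FewDes :: "'a set \<Rightarrow> 'a list set \<Rightarrow> 'a list \<Rightarrow> bool" where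
  "FewDes X L \<alpha> \<longleftrightarrow>
    (\<forall>C\<in>par X L \<alpha>. card C \<ge> 2 \<longrightarrow> (\<forall>x\<in>C. des X L \<alpha> x = {}))"

definition SynMon :: "'a set \<Rightarrow> 'a list set \<Rightarrow> ('a list \<Rightarrow> real) \<Rightarrow> 'a list \<Rightarrow> bool" where
  "SynMon X L \<omega> \<alpha> \<longleftrightarrow>
    (\<forall>x\<in>cont X L \<alpha>. (\<omega> (\<alpha> @ [x]))\<^sup>2 \<ge> (\<Sum>y\<in>des X L \<alpha> x. \<omega> \<alpha> * \<omega> (\<alpha> @ [x, y])))"

definition class_b :: "'a set \<Rightarrow> 'a list set \<Rightarrow> ('a list \<Rightarrow> real) \<Rightarrow> 'a list \<Rightarrow> 'a set \<Rightarrow> real" where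
  "class_b X L \<omega> \<alpha> C =
    (if is_singleton C
     then let x = the_elem C in
       \<Sum>y\<in>des X L \<alpha> x. \<omega> \<alpha> * \<omega> (\<alpha> @ [x, y]) / (\<omega> (\<alpha> @ [x]))\<^sup>2
     else 0)"

text \<open>The first disjunct is the convention that the inequality counts as satisfied when its
  prefactor is nonpositive; otherwise the denominators are required to be positive.\<close>

definition ScaleMon ::
    "'a set \<Rightarrow> 'a list set \<Rightarrow> ('a list \<Rightarrow> real) \<Rightarrow> (nat \<Rightarrow> real) \<Rightarrow> 'a list \<Rightarrow> bool" where
  "ScaleMon X L \<omega> c \<alpha> \<longleftrightarrow>
    (let l = length \<alpha> in
      (c (l + 1))\<^sup>2 \<ge> c l * c (l + 2) \<or>
      (\<forall>C\<in>par X L \<alpha>. class_b X L \<omega> \<alpha> C < 1) \<and>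
      (1 - (c (l + 1))\<^sup>2 / (c l * c (l + 2))) * (\<Sum>C\<in>par X L \<alpha>. 1 / (1 - class_b X L \<omega> \<alpha> C)) \<le> 1)"

text \<open>Only the values \<open>c 0, \<dots>, c (greedoid_rk L)\<close> of the scale sequence matter, and only the
  values of \<open>q\<close> on \<open>L\<close>.\<close>

definition k_admissible :: "'a set \<Rightarrow> 'a list set \<Rightarrow> nat \<Rightarrow> ('a list \<Rightarrow> real) \<Rightarrow> bool" where
  "k_admissible X L k q \<longleftrightarrow>
    (\<exists>c :: nat \<Rightarrow> real. (\<forall>i\<le>greedoid_rk L. c i > 0) \<and>
      (\<forall>\<alpha>\<in>L. length \<alpha> < k \<longrightarrow>
        ContInv X L q \<alpha> \<and> PAMon X L q \<alpha> \<and> LogMod X L (scaled L q c) \<alpha> \<and> FewDes X L \<alpha> \<and>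
        SynMon X L (scaled L q c) \<alpha> \<and> ScaleMon X L (scaled L q c) c \<alpha>))"

definition level_sum :: "'a list set \<Rightarrow> ('a list \<Rightarrow> real) \<Rightarrow> nat \<Rightarrow> real" where
  "level_sum L q j = (\<Sum>\<alpha> | \<alpha> \<in> L \<and> length \<alpha> = j. q \<alpha>)"

end

theory Submission
  imports Defs
begin

text \<open>The combinatorial atlas of Chan and Pak. For \<open>\<alpha> \<in> L\<close> and \<open>j\<close>, a symmetric bilinear form on the
  functions on \<open>X \<union> {null}\<close> is built from sums of \<open>q\<close> over continuations of \<open>\<alpha>\<close>. For the empty word
  and \<open>j = k - 1\<close>, the indicators of \<open>X\<close> and of \<open>null\<close> give the values \<open>L\<^sub>q(k+1)\<close>, \<open>L\<^sub>q(k)\<close>, \<open>L\<^sub>q(k-1)\<close>,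
  so the claim is the reversed Cauchy-Schwarz inequality for this form. That inequality is proved by
  induction on \<open>j\<close>. For \<open>j = 0\<close>, (LogMod), (FewDes), (SynMon) and (ScaleMon) make the form nonpositive
  on a hyperplane. In the step, each coordinate of the matrix at \<open>\<alpha>\<close> is a value of the form at
  \<open>\<alpha>\<close> or some \<open>\<alpha>x\<close> with index \<open>j\<close>; the induction hypothesis together with (ContInv) and (PAMon)
  then shows that a normalisation \<open>N\<close> of the matrix satisfies \<open>N \<le> N\<^sup>2\<close>, so that it has no
  eigenvalue in \<open>(0, 1)\<close>, while the Perron-Frobenius eigenvalue is \<open>1\<close> and simple.\<close>

section \<open>Hyperbolic quadratic forms\<close>

lemma square_le_of_nonneg_quadratic:
  fixes a b c :: real
  assumes "\<And>r. 0 \<le> a + 2 * r * b + r\<^sup>2 * c" and "0 \<le> c"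
  shows "b\<^sup>2 \<le> a * c"
proof (cases "c = 0")
  case True
  have "b = 0"
  proof (rule ccontr)
    assume "b \<noteq> 0"
    \<comment> \<open>For \<open>c = 0\<close> the quadratic is linear in \<open>r\<close>, and this
      \<open>r\<close> gives it the value \<open>-1\<close>.\<close>
    then show False
      using assms(1)[of "- (a + 1) / (2 * b)"] True by (simp add: field_simps)
  qed
  then show ?thesis using True by simp
next
  case False
  have "0 \<le> (a + 2 * (- b / c) * b + (- b / c)\<^sup>2 * c) * c"
    using assms by (intro mult_nonneg_nonneg)
  also have "\<dots> = a * c - b\<^sup>2"
    using False by (simp add: field_simps power2_eq_square)
  finally show ?thesis by simp
qed

text \<open>The quadratic in \<open>r\<close> with these coefficients is the sum of the squares of
  \<open>1 + r * e i * p i\<close>, each divided by \<open>e i\<close>.\<close>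

lemma weighted_Cauchy_Schwarz:
  fixes e p :: "'a \<Rightarrow> real"
  assumes "\<And>i. i \<in> A \<Longrightarrow> 0 < e i"
  shows "(\<Sum>i\<in>A. p i)\<^sup>2 \<le> (\<Sum>i\<in>A. 1 / e i) * (\<Sum>i\<in>A. e i * (p i)\<^sup>2)"
proof (rule square_le_of_nonneg_quadratic)
  fix r
  have "0 \<le> (\<Sum>i\<in>A. 1 / e i * (1 + r * (e i * p i))\<^sup>2)"
    using assms by (intro sum_nonneg mult_nonneg_nonneg) (auto intro: less_imp_le)
  also have "\<dots> = (\<Sum>i\<in>A. 1 / e i + 2 * r * p i + r\<^sup>2 * (e i * (p i)\<^sup>2))"
  proof (intro sum.cong refl)
    fix i assume "i \<in> A"
    then have "e i \<noteq> 0" using assms by fastforce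
    then show "1 / e i * (1 + r * (e i * p i))\<^sup>2 = 1 / e i + 2 * r * p i + r\<^sup>2 * (e i * (p i)\<^sup>2)"
      by (simp add: power2_eq_square field_simps)
  qed
  finally show "0 \<le> (\<Sum>i\<in>A. 1 / e i) + 2 * r * (\<Sum>i\<in>A. p i) + r\<^sup>2 * (\<Sum>i\<in>A. e i * (p i)\<^sup>2)"
    by (simp add: sum.distrib sum_distrib_left)
next
  show "0 \<le> (\<Sum>i\<in>A. e i * (p i)\<^sup>2)"
    using assms by (intro sum_nonneg mult_nonneg_nonneg) (auto intro: less_imp_le)
qed

text \<open>The Cauchy-Schwarz inequality with its sign reversed. For a symmetric form in finite
  dimension this means that at most one eigenvalue is positive.\<close>

definition hyperbolic :: "(('i \<Rightarrow> real) \<Rightarrow> ('i \<Rightarrow> real) \<Rightarrow> real) \<Rightarrow> bool" where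
  "hyperbolic F \<longleftrightarrow> (\<forall>x y. F y y > 0 \<longrightarrow> F x x * F y y \<le> (F x y)\<^sup>2)"

text \<open>If \<open>F y y > 0\<close> then \<open>l y\<close> is nonzero, so the line through
  \<open>x\<close> in direction \<open>y\<close> meets the kernel of \<open>l\<close>. There
  \<open>F\<close> is nonpositive, and completing the square gives the inequality.\<close>

lemma hyperbolicI:
  fixes l :: "('i \<Rightarrow> real) \<Rightarrow> real"
  assumes l: "\<And>x y r. l (\<lambda>i. x i + r * y i) = l x + r * l y"
    and F: "\<And>x y r. F (\<lambda>i. x i + r * y i) (\<lambda>i. x i + r * y i) = F x x + 2 * r * F x y + r\<^sup>2 * F y y"
    and neg: "\<And>z. l z = 0 \<Longrightarrow> F z z \<le> 0"
  shows "hyperbolic F"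
  unfolding hyperbolic_def
proof (intro allI impI)
  fix x y assume pos: "F y y > 0"
  then have "l y \<noteq> 0" using neg[of y] by fastforce
  define r where "r = - l x / l y"
  have "l (\<lambda>i. x i + r * y i) = 0"
    using \<open>l y \<noteq> 0\<close> unfolding l by (simp add: r_def)
  from neg[OF this] have "F y y * (F x x + 2 * r * F x y + r\<^sup>2 * F y y) \<le> 0"
    unfolding F using pos by (simp add: mult_le_0_iff)
  moreover have "F y y * (F x x + 2 * r * F x y + r\<^sup>2 * F y y)
      = (r * F y y + F x y)\<^sup>2 + F x x * F y y - (F x y)\<^sup>2"
    by (simp add: algebra_simps power2_eq_square)
  ultimately show "F x x * F y y \<le> (F x y)\<^sup>2"
    using zero_le_power2[of "r * F y y + F x y"] by linarith
qed

section \<open>Bilinear forms of symmetric matrices\<close>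

definition matrix_form :: "'i set \<Rightarrow> ('i \<Rightarrow> 'i \<Rightarrow> real) \<Rightarrow> ('i \<Rightarrow> real) \<Rightarrow> ('i \<Rightarrow> real) \<Rightarrow> real" where
  "matrix_form S M u v = (\<Sum>i\<in>S. u i * (\<Sum>j\<in>S. M i j * v j))"

lemma matrix_form_add_right:
  "matrix_form S M u (\<lambda>i. v i + r * w i) = matrix_form S M u v + r * matrix_form S M u w"
  by (simp add: matrix_form_def sum.distrib sum_distrib_left algebra_simps)

lemma matrix_form_add_left:
  "matrix_form S M (\<lambda>i. v i + r * w i) u = matrix_form S M v u + r * matrix_form S M w u"
  by (simp add: matrix_form_def sum.distrib sum_distrib_left algebra_simps)

lemma matrix_form_commute:
  assumes "\<And>i j. i \<in> S \<Longrightarrow> j \<in> S \<Longrightarrow> M i j = M j i"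
  shows "matrix_form S M u v = matrix_form S M v u"
proof -
  have "matrix_form S M u v = (\<Sum>i\<in>S. \<Sum>j\<in>S. M i j * u i * v j)"
    by (simp add: matrix_form_def sum_distrib_left algebra_simps)
  also have "\<dots> = (\<Sum>i\<in>S. \<Sum>j\<in>S. M j i * u j * v i)"
    by (rule sum.swap)
  also have "\<dots> = (\<Sum>i\<in>S. \<Sum>j\<in>S. M i j * u j * v i)"
    using assms by (intro sum.cong) auto
  also have "\<dots> = matrix_form S M v u"
    by (simp add: matrix_form_def sum_distrib_left algebra_simps)
  finally show ?thesis .
qed

text \<open>With \<open>D\<close> the diagonal matrix of the \<open>(M h)\<^sub>i / h\<^sub>i\<close>, the matrix \<open>N = D\<^sup>-\<^sup>1 M\<close> is self-adjoint for
  the inner product \<open>E\<close> given by \<open>D\<close> and fixes \<open>h\<close>. Its spectrum on the complement of \<open>h\<close> lies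
  in \<open>[-1, 1 - \<delta>]\<close>, and \<open>dom\<close> says that it avoids \<open>(0, 1)\<close>. Instead of diagonalising \<open>N\<close>, a bound
  \<open>\<mu>\<close> for the spectrum is improved to \<open>\<rho> \<mu>\<close> with a fixed \<open>\<rho> < 1\<close> by the Cauchy-Schwarz
  inequality for the form \<open>\<mu> E - M\<close>.\<close>

lemma matrix_form_nonpos_on_complement:
  fixes M :: "'i \<Rightarrow> 'i \<Rightarrow> real" and h :: "'i \<Rightarrow> real"
  assumes fin: "finite S" and o: "p \<in> S"
    and sym: "\<And>i j. i \<in> S \<Longrightarrow> j \<in> S \<Longrightarrow> M i j = M j i"
    and nonneg: "\<And>i j. i \<in> S \<Longrightarrow> j \<in> S \<Longrightarrow> 0 \<le> M i j"
    and pos: "\<And>i. i \<in> S \<Longrightarrow> 0 < M i p"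
    and h: "\<And>i. i \<in> S \<Longrightarrow> 0 < h i"
    and dom: "\<And>v. matrix_form S M v v
      \<le> (\<Sum>i\<in>S. h i / (\<Sum>j\<in>S. M i j * h j) * (\<Sum>j\<in>S. M i j * v j)\<^sup>2)"
    and orth: "matrix_form S M v h = 0"
  shows "matrix_form S M v v \<le> 0"
proof -
  define d where "d i = (\<Sum>j\<in>S. M i j * h j) / h i" for i
  define B where "B = matrix_form S M"
  define E where "E u v = (\<Sum>i\<in>S. d i * u i * v i)" for u v
  define N where "N v i = (\<Sum>j\<in>S. M i j * v j) / d i" for v i
  have Mh: "0 < (\<Sum>j\<in>S. M i j * h j)" if "i \<in> S" for i
    using fin o nonneg[OF that] pos[OF that] h
    by (intro sum_pos2[of _ p]) (auto intro!: mult_nonneg_nonneg intro: less_imp_le)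
  have d: "0 < d i" if "i \<in> S" for i
    using Mh[OF that] h[OF that] by (simp add: d_def)
  have B_commute: "B u v = B v u" for u v
    unfolding B_def using sym by (rule matrix_form_commute)
  have E_commute: "E u v = E v u" for u v
    by (simp add: E_def mult.commute mult.left_commute)
  have E_add_right: "E u (\<lambda>i. v i + r * w i) = E u v + r * E u w" for u v w r
    by (simp add: E_def sum.distrib sum_distrib_left algebra_simps)
  have E_nonneg: "0 \<le> E v v" for v
    unfolding E_def by (intro sum_nonneg) (metis d less_imp_le mult.assoc mult_nonneg_nonneg zero_le_square)
  have E_N: "E u (N v) = B u v" for u v
    unfolding E_def B_def matrix_form_def N_def using d
    by (intro sum.cong refl) (force simp: field_simps)
  have E_h: "E v h = B v h" for v
    unfolding E_def B_def matrix_form_def d_def using h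
    by (intro sum.cong refl) (force simp: field_simps)
  \<comment> \<open>\<open>N\<close> preserves the complement of \<open>h\<close>: against
    \<open>h\<close> the forms \<open>E\<close> and \<open>B\<close> agree, and \<open>E_N\<close>
    with the symmetry of both makes \<open>N\<close> self-adjoint.\<close>
  have orth_N: "B (N v) h = 0" if "B v h = 0" for v
    using that E_h[of "N v"] E_commute[of "N v" h] E_N[of h v] B_commute[of h v] by simp
  have dom': "B v v \<le> E (N v) (N v)" for v
  proof -
    have "(\<Sum>i\<in>S. h i / (\<Sum>j\<in>S. M i j * h j) * (\<Sum>j\<in>S. M i j * v j)\<^sup>2) = E (N v) (N v)"
      unfolding E_def N_def d_def using h Mh
      by (intro sum.cong refl) (force simp: field_simps power2_eq_square)
    then show ?thesis using dom[of v] by (simp add: B_def)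
  qed
  \<comment> \<open>The energy of a weighted graph with edge weights
    \<open>M i j * h i * h j\<close>. Taking \<open>t = 1\<close> bounds the spectrum below by
    \<open>-1\<close>; taking \<open>t = -1\<close> gives the gap below \<open>1\<close>.\<close>
  have squares: "2 * (E v v + t * B v v)
      = (\<Sum>i\<in>S. \<Sum>j\<in>S. M i j * h i * h j * (v i / h i + t * (v j / h j))\<^sup>2)" if "t\<^sup>2 = 1" for t v
  proof -
    have E1: "E v v = (\<Sum>i\<in>S. \<Sum>j\<in>S. M i j * h i * h j * (v i / h i)\<^sup>2)"
      unfolding E_def d_def
    proof (rule sum.cong[OF refl])
      fix i assume "i \<in> S"
      have "(\<Sum>j\<in>S. M i j * h i * h j * (v i / h i)\<^sup>2) = (\<Sum>j\<in>S. M i j * h j) * (h i * (v i / h i)\<^sup>2)"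
        by (simp add: sum_distrib_left sum_distrib_right mult_ac)
      then show "(\<Sum>j\<in>S. M i j * h j) / h i * v i * v i = (\<Sum>j\<in>S. M i j * h i * h j * (v i / h i)\<^sup>2)"
        using h[OF \<open>i \<in> S\<close>] by (simp add: power2_eq_square)
    qed
    have "E v v = (\<Sum>i\<in>S. \<Sum>j\<in>S. M j i * h j * h i * (v j / h j)\<^sup>2)"
      unfolding E1 by (rule sum.swap)
    then have E2: "E v v = (\<Sum>i\<in>S. \<Sum>j\<in>S. M i j * h i * h j * (v j / h j)\<^sup>2)"
      using sym by (simp add: mult.commute mult.left_commute cong: sum.cong)
    have B1: "B v v = (\<Sum>i\<in>S. \<Sum>j\<in>S. M i j * v i * v j)"
      by (simp add: B_def matrix_form_def sum_distrib_left algebra_simps)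
    have "2 * (E v v + t * B v v) = E v v + E v v + 2 * t * B v v" by simp
    also have "\<dots> = (\<Sum>i\<in>S. \<Sum>j\<in>S. M i j * h i * h j * (v i / h i)\<^sup>2
        + M i j * h i * h j * (v j / h j)\<^sup>2 + 2 * t * (M i j * v i * v j))"
      by (subst (1) E1, subst (1) E2, subst B1) (simp add: sum.distrib sum_distrib_left)
    also have "\<dots> = (\<Sum>i\<in>S. \<Sum>j\<in>S. M i j * h i * h j * (v i / h i + t * (v j / h j))\<^sup>2)"
    proof (intro sum.cong refl)
      fix i j assume "i \<in> S" "j \<in> S"
      then have "h i \<noteq> 0" "h j \<noteq> 0" using h by fastforce+
      then have "v i * v j = h i * h j * (v i / h i) * (v j / h j)" by simp
      then have *: "M i j * v i * v j = M i j * h i * h j * (v i / h i) * (v j / h j)"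
        by (metis mult.assoc)
      show "M i j * h i * h j * (v i / h i)\<^sup>2 + M i j * h i * h j * (v j / h j)\<^sup>2
          + 2 * t * (M i j * v i * v j) = M i j * h i * h j * (v i / h i + t * (v j / h j))\<^sup>2"
        unfolding * power2_sum power_mult_distrib that by (simp add: algebra_simps)
    qed
    finally show ?thesis .
  qed
  have weight_nonneg: "0 \<le> M i j * h i * h j" if "i \<in> S" "j \<in> S" for i j
    using that nonneg h by (intro mult_nonneg_nonneg) (auto intro: less_imp_le)
  have B_ge: "- E v v \<le> B v v" for v
  proof -
    have "0 \<le> 2 * (E v v + 1 * B v v)"
      unfolding squares[OF one_power2]
      by (intro sum_nonneg mult_nonneg_nonneg[OF weight_nonneg]) auto
    then show ?thesis by simp
  qed
  \<comment> \<open>\<open>2 * \<delta>\<close> is at most the share of the index \<open>p\<close>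
    in every \<open>(M h)_i\<close>, which is positive because the column \<open>p\<close> is. The
    cap \<open>1\<close> keeps \<open>1 - \<delta>\<close> nonnegative.\<close>
  obtain \<delta> where \<delta>: "0 < \<delta>" "\<delta> \<le> 1"
    and \<delta>_le: "\<And>i. i \<in> S \<Longrightarrow> 2 * \<delta> * (\<Sum>j\<in>S. M i j * h j) \<le> M i p * h p"
  proof
    let ?f = "\<lambda>i. M i p * h p / (2 * (\<Sum>j\<in>S. M i j * h j))"
    let ?\<delta> = "Min (insert 1 (?f ` S))"
    show "0 < ?\<delta>"
      using fin pos h o Mh by (subst Min_gr_iff) auto
    show "?\<delta> \<le> 1"
      using fin by (intro Min_le) auto
    show "2 * ?\<delta> * (\<Sum>j\<in>S. M i j * h j) \<le> M i p * h p" if "i \<in> S" for i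
    proof -
      have "?\<delta> \<le> ?f i" using fin that by (intro Min_le) auto
      then have "?\<delta> * (2 * (\<Sum>j\<in>S. M i j * h j)) \<le> M i p * h p"
        using Mh[OF that] by (subst (asm) pos_le_divide_eq) auto
      then show ?thesis by (simp add: mult.assoc mult.left_commute)
    qed
  qed
  \<comment> \<open>Subtracting the multiple of \<open>h\<close> that makes \<open>v\<close> vanish
    at \<open>p\<close> cannot decrease \<open>E v v\<close>, because
    \<open>E v h = B v h = 0\<close>. The result is compared with the terms \<open>j = p\<close> of
    the double sum in \<open>squares\<close>.\<close>
  have gap: "B v v \<le> (1 - \<delta>) * E v v" if "B v h = 0" for v
  proof -
    define y where "y = v p / h p"
    define W where "W i = h i * (v i / h i - y)\<^sup>2" for i
    define g where "g i = (\<Sum>j\<in>S. M i j * h j)" for i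
    have W: "0 \<le> W i" if "i \<in> S" for i
      using h[OF that] by (simp add: W_def)
    have "\<delta> * E v v \<le> \<delta> * (E v v + y\<^sup>2 * E h h)"
      using \<delta> E_nonneg[of h] by simp
    also have "E v v + y\<^sup>2 * E h h = E (\<lambda>i. v i + (-y) * h i) (\<lambda>i. v i + (-y) * h i)"
      using that by (simp only: E_add_right E_commute[of "\<lambda>i. v i + (-y) * h i"] E_h E_commute[of h v])
        (simp add: power2_eq_square)
    also have "\<dots> = (\<Sum>i\<in>S. g i * W i)"
      unfolding E_def d_def g_def W_def using h
      by (intro sum.cong refl) (force simp: field_simps power2_eq_square)
    finally have 1: "\<delta> * E v v \<le> \<delta> * (\<Sum>i\<in>S. g i * W i)" .
    have "2 * (\<delta> * (\<Sum>i\<in>S. g i * W i)) = (\<Sum>i\<in>S. 2 * \<delta> * g i * W i)"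
      by (simp add: sum_distrib_left mult.assoc)
    also have "\<dots> \<le> (\<Sum>i\<in>S. M i p * h p * W i)"
      unfolding g_def by (intro sum_mono mult_right_mono \<delta>_le W)
    also have "\<dots> = (\<Sum>i\<in>S. M i p * h i * h p * (v i / h i + (-1) * (v p / h p))\<^sup>2)"
      by (simp add: W_def y_def mult_ac)
    also have "\<dots> \<le> (\<Sum>i\<in>S. \<Sum>j\<in>S. M i j * h i * h j * (v i / h i + (-1) * (v j / h j))\<^sup>2)"
    proof (rule sum_mono)
      fix i assume i: "i \<in> S"
      show "M i p * h i * h p * (v i / h i + (-1) * (v p / h p))\<^sup>2
          \<le> (\<Sum>j\<in>S. M i j * h i * h j * (v i / h i + (-1) * (v j / h j))\<^sup>2)"
        by (rule member_le_sum[OF o _ fin]) (use weight_nonneg[OF i] in auto)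
    qed
    also have "\<dots> = 2 * (E v v + (-1) * B v v)"
      by (rule squares[symmetric]) simp
    finally show ?thesis using 1 by (simp add: algebra_simps)
  qed
  define \<rho> where "\<rho> = 1 / (1 + \<delta>\<^sup>2 / 2)"
  have \<rho>: "0 < \<rho>" "\<rho> < 1"
    using \<delta> by (auto simp: \<rho>_def field_simps add_pos_nonneg add_pos_pos)
  \<comment> \<open>The span of \<open>v\<close> and \<open>N v\<close> stays in the complement of
    \<open>h\<close>, so \<open>\<mu> E - B\<close> satisfies Cauchy-Schwarz on it. Its left side is
    at least the square of \<open>\<delta> * n\<close>, since \<open>B v v \<le> n\<close> and
    \<open>\<mu> \<le> 1 - \<delta>\<close>; the last factor is at most \<open>2 * n\<close>, since
    \<open>B \<ge> - E\<close>. Cancelling \<open>n\<close> and solving for \<open>B v v\<close>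
    produces \<open>\<rho>\<close>.\<close>
  have improve: "B v v \<le> \<mu> * \<rho> * E v v"
    if \<mu>: "0 \<le> \<mu>" "\<mu> \<le> 1 - \<delta>" and bound: "\<And>v. B v h = 0 \<Longrightarrow> B v v \<le> \<mu> * E v v" and v: "B v h = 0" for v \<mu>
  proof (cases "B v v \<le> 0")
    case True
    also have "0 \<le> \<mu> * \<rho> * E v v" using \<mu> \<rho> E_nonneg by simp
    finally show ?thesis .
  next
    case False
    define n where "n = E (N v) (N v)"
    have n: "B v v \<le> n" using dom' by (simp add: n_def)
    then have "0 < n" using False by simp
    have "(\<mu> * E v (N v) - B v (N v))\<^sup>2 \<le> (\<mu> * E v v - B v v) * (\<mu> * n - B (N v) (N v))"
    proof (rule square_le_of_nonneg_quadratic)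
      fix r
      have "B (\<lambda>i. v i + r * N v i) h = 0"
        using v orth_N[OF v] by (simp add: B_def matrix_form_add_left)
      from bound[OF this] show "0 \<le> \<mu> * E v v - B v v + 2 * r * (\<mu> * E v (N v) - B v (N v))
          + r\<^sup>2 * (\<mu> * n - B (N v) (N v))"
        unfolding n_def E_add_right E_commute[of "\<lambda>i. v i + r * N v i"]
          matrix_form_add_right[of S M, folded B_def] matrix_form_add_left[of S M, folded B_def]
        using E_commute[of "N v" v] B_commute[of "N v" v]
        by (simp add: algebra_simps power2_eq_square)
    next
      show "0 \<le> \<mu> * n - B (N v) (N v)"
        using bound[OF orth_N[OF v]] by (simp add: n_def)
    qed
    also have "E v (N v) = B v v" by (rule E_N)
    also have "B v (N v) = n"
      unfolding n_def E_N by (rule B_commute)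
    also have "(\<mu> * E v v - B v v) * (\<mu> * n - B (N v) (N v)) \<le> (\<mu> * E v v - B v v) * (2 * n)"
    proof (rule mult_left_mono)
      have "\<mu> * n \<le> 1 * n" using \<mu> \<delta> \<open>0 < n\<close> by (intro mult_right_mono) auto
      then show "\<mu> * n - B (N v) (N v) \<le> 2 * n"
        using B_ge[of "N v"] by (simp add: n_def)
      show "0 \<le> \<mu> * E v v - B v v" using bound[OF v] by simp
    qed
    finally have le: "(\<mu> * B v v - n)\<^sup>2 \<le> (\<mu> * E v v - B v v) * (2 * n)" .
    have "\<delta> * n \<le> (1 - \<mu>) * n"
      using \<mu> \<open>0 < n\<close> by (intro mult_right_mono) auto
    also have "\<dots> \<le> n - \<mu> * B v v"
      using mult_left_mono[OF n \<mu>(1)] by (simp add: algebra_simps)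
    finally have "(\<delta> * n)\<^sup>2 \<le> (n - \<mu> * B v v)\<^sup>2"
      using \<delta> \<open>0 < n\<close> by (intro power_mono) auto
    also have "\<dots> \<le> (\<mu> * E v v - B v v) * (2 * n)"
      using le by (simp add: power2_commute)
    finally have "n * (\<delta>\<^sup>2 * n) \<le> n * (2 * (\<mu> * E v v - B v v))"
      by (simp add: power2_eq_square algebra_simps)
    then have "\<delta>\<^sup>2 * n \<le> 2 * (\<mu> * E v v - B v v)"
      using \<open>0 < n\<close> by (simp only: mult_le_cancel_left_pos)
    moreover have "\<delta>\<^sup>2 * B v v \<le> \<delta>\<^sup>2 * n"
      using n by (intro mult_left_mono) auto
    ultimately have "B v v * (1 + \<delta>\<^sup>2 / 2) \<le> \<mu> * E v v"
      by (simp add: algebra_simps)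
    moreover have "0 < 1 + \<delta>\<^sup>2 / 2" by (simp add: add_pos_nonneg)
    ultimately have "B v v \<le> \<mu> * E v v / (1 + \<delta>\<^sup>2 / 2)"
      by (simp only: pos_le_divide_eq)
    then show ?thesis by (simp add: \<rho>_def)
  qed
  have iterate: "B v v \<le> (1 - \<delta>) * \<rho> ^ n * E v v" if "B v h = 0" for v n
    using that
  proof (induction n arbitrary: v)
    case 0
    then show ?case using gap by simp
  next
    case (Suc n)
    have "\<rho> ^ n \<le> 1" using \<rho> by (intro power_le_one) auto
    then have "(1 - \<delta>) * \<rho> ^ n \<le> 1 - \<delta>" using \<delta> by (intro mult_left_le) auto
    then show ?case
      using improve[of "(1 - \<delta>) * \<rho> ^ n"] Suc \<delta> \<rho> by (simp add: mult.commute mult.left_commute)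
  qed
  have "(\<lambda>n. (1 - \<delta>) * \<rho> ^ n * E v v) \<longlonglongrightarrow> (1 - \<delta>) * 0 * E v v"
    using \<rho> by (intro tendsto_intros LIMSEQ_realpow_zero) auto
  then have "B v v \<le> (1 - \<delta>) * 0 * E v v"
    by (rule LIMSEQ_le_const) (use iterate orth in \<open>auto simp: B_def\<close>)
  then show ?thesis by (simp add: B_def)
qed

section \<open>Forms of the combinatorial atlas\<close>

text \<open>The double sum is half the sum of \<open>f x y + f y x\<close>. The contributions of the
  words \<open>\<alpha> @ [x, y]\<close> and \<open>\<alpha> @ [y, x]\<close> can be controlled only
  as a pair.\<close>

lemma sum_nonneg_by_swap:
  fixes f :: "'a \<Rightarrow> 'a \<Rightarrow> real"
  assumes "\<And>x y. x \<in> A \<Longrightarrow> y \<in> A \<Longrightarrow> 0 \<le> f x y + f y x"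
  shows "0 \<le> (\<Sum>x\<in>A. \<Sum>y\<in>A. f x y)"
proof -
  have "0 \<le> (\<Sum>x\<in>A. \<Sum>y\<in>A. f x y + f y x)"
    using assms by (intro sum_nonneg)
  also have "\<dots> = (\<Sum>x\<in>A. \<Sum>y\<in>A. f x y) + (\<Sum>x\<in>A. \<Sum>y\<in>A. f x y)"
    by (simp add: sum.distrib sum.swap[of "\<lambda>x y. f y x"])
  finally show ?thesis by simp
qed

lemma sum_zero_by_swap:
  fixes f :: "'a \<Rightarrow> 'a \<Rightarrow> real"
  assumes "\<And>x y. x \<in> A \<Longrightarrow> y \<in> A \<Longrightarrow> f x y + f y x = 0"
  shows "(\<Sum>x\<in>A. \<Sum>y\<in>A. f x y) = 0"
  using sum_nonneg_by_swap[of A f] sum_nonneg_by_swap[of A "\<lambda>x y. - f x y"] assms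
  by (force simp: sum_negf)

text \<open>The recursion peels off the first letter, which fits the inductions on \<open>j\<close>;
  \<open>sum_cont_words\<close> identifies it with the sum over continuations. Letters that do not
  continue the word contribute 0 through \<open>zero_ext\<close>.\<close>

primrec cont_sum :: "'a set \<Rightarrow> 'a list set \<Rightarrow> ('a list \<Rightarrow> real) \<Rightarrow> nat \<Rightarrow> 'a list \<Rightarrow> real" where
  "cont_sum X L q 0 \<alpha> = zero_ext L q \<alpha>"
| "cont_sum X L q (Suc j) \<alpha> = (\<Sum>x\<in>X. cont_sum X L q j (\<alpha> @ [x]))"

lemma (in greedoid) sum_cont_words:
  "(\<Sum>\<beta>\<in>cont_words X L j \<alpha>. zero_ext L q (\<alpha> @ \<beta>)) = cont_sum X L q j \<alpha>"
proof (induction j arbitrary: \<alpha>)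
  case 0
  have "cont_words X L 0 \<alpha> = (if \<alpha> \<in> L then {[]} else {})"
    by (auto simp: cont_words_def)
  then show ?case by (simp add: zero_ext_def)
next
  case (Suc j)
  have fin: "finite (cont_words X L j \<beta>)" for \<beta>
    by (rule finite_subset[OF _ finite_lists_length_eq[OF finite_X, of j]]) (auto simp: cont_words_def)
  have words: "cont_words X L (Suc j) \<alpha>
      = (\<lambda>(x, \<beta>). x # \<beta>) ` (SIGMA x:X. cont_words X L j (\<alpha> @ [x]))"
  proof (intro equalityI subsetI)
    fix \<gamma> assume \<gamma>: "\<gamma> \<in> cont_words X L (Suc j) \<alpha>"
    then obtain x \<beta> where "\<gamma> = x # \<beta>" by (auto simp: cont_words_def length_Suc_conv)
    with \<gamma> show "\<gamma> \<in> (\<lambda>(x, \<beta>). x # \<beta>) ` (SIGMA x:X. cont_words X L j (\<alpha> @ [x]))"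
      using hereditary[of "\<alpha> @ [x]" \<beta>] by (auto simp: cont_words_def)
  qed (auto simp: cont_words_def intro: hereditary)
  have "(\<Sum>\<beta>\<in>cont_words X L (Suc j) \<alpha>. zero_ext L q (\<alpha> @ \<beta>))
      = (\<Sum>(x, \<beta>)\<in>(SIGMA x:X. cont_words X L j (\<alpha> @ [x])). zero_ext L q ((\<alpha> @ [x]) @ \<beta>))"
    unfolding words by (subst sum.reindex) (auto simp: inj_on_def intro!: sum.cong)
  also have "\<dots> = (\<Sum>x\<in>X. \<Sum>\<beta>\<in>cont_words X L j (\<alpha> @ [x]). zero_ext L q ((\<alpha> @ [x]) @ \<beta>))"
    using finite_X fin by (subst sum.Sigma) auto
  also have "\<dots> = cont_sum X L q (Suc j) \<alpha>"
    by (simp only: Suc.IH cont_sum.simps)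
  finally show ?case .
qed

section \<open>Continuation sums and the bilinear form attached to a word\<close>

locale weighted_greedoid = greedoid X L for X :: "'a set" and L :: "'a list set" +
  fixes q :: "'a list \<Rightarrow> real"
  assumes q_pos: "\<alpha> \<in> L \<Longrightarrow> 0 < q \<alpha>"
begin

abbreviation "C \<equiv> cont X L"
abbreviation "B \<equiv> cont_sum X L q"

lemma mem_C: "x \<in> C \<alpha> \<longleftrightarrow> \<alpha> @ [x] \<in> L"
  using L_words hereditary[of \<alpha> "[x]"] by (auto simp: cont_def cont_words_def)

lemma C_subset: "C \<alpha> \<subseteq> X"
  using L_words by (auto simp: mem_C)

lemma finite_C: "finite (C \<alpha>)"
  using C_subset finite_X by (rule finite_subset)

lemma not_in_L_append: "\<alpha> \<notin> L \<Longrightarrow> \<alpha> @ \<beta> \<notin> L"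
  using hereditary by blast

lemma B_outside: "\<alpha> \<notin> L \<Longrightarrow> B j \<alpha> = 0"
  by (induction j arbitrary: \<alpha>) (auto simp: zero_ext_def not_in_L_append)

lemma B_outside_append: "\<alpha> \<notin> L \<Longrightarrow> B j (\<alpha> @ \<beta>) = 0"
  by (simp add: B_outside not_in_L_append)

lemma B_nonneg: "0 \<le> B j \<alpha>"
  using q_pos by (induction j arbitrary: \<alpha>) (auto simp: zero_ext_def less_imp_le intro: sum_nonneg)

lemma extend_word:
  assumes "\<alpha> \<in> L" "length \<alpha> < greedoid_rk L"
  shows "\<exists>x\<in>X. \<alpha> @ [x] \<in> L"
proof -
  have "Max (length ` L) \<in> length ` L"
    using finite_L Nil_in_L by (intro Max_in) auto
  then obtain \<beta> where "\<beta> \<in> L" "length \<beta> = greedoid_rk L"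
    by (auto simp: greedoid_rk_def)
  then show ?thesis using exchange[of \<beta> \<alpha>] assms L_words by auto
qed

lemma B_pos:
  assumes "\<alpha> \<in> L" "length \<alpha> + j \<le> greedoid_rk L"
  shows "0 < B j \<alpha>"
  using assms
proof (induction j arbitrary: \<alpha>)
  case 0
  then show ?case using q_pos by (simp add: zero_ext_def)
next
  case (Suc j)
  then obtain x where "x \<in> X" "\<alpha> @ [x] \<in> L" using extend_word by force
  then show ?case
    using Suc finite_X B_nonneg by (auto intro!: sum_pos2[of _ x])
qed

text \<open>The suffix \<open>\<gamma>\<close> is arbitrary because each unfolding of
  \<open>B\<close> appends a letter to the right of the exchanged pair.\<close>

lemma B_swap:
  assumes "ContInv X L q \<alpha>" "x \<in> C \<alpha>" "y \<in> C \<alpha>" "\<gamma> \<in> lists X"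
  shows "B j (\<alpha> @ [x, y] @ \<gamma>) = B j (\<alpha> @ [y, x] @ \<gamma>)"
  using assms(4)
proof (induction j arbitrary: \<gamma>)
  case 0
  then show ?case using assms by (auto simp: ContInv_def)
next
  case (Suc j)
  have "B j (\<alpha> @ [x, y] @ \<gamma> @ [z]) = B j (\<alpha> @ [y, x] @ \<gamma> @ [z])" if "z \<in> X" for z
    using Suc that by (intro Suc.IH) auto
  then show ?case by (simp cong: sum.cong)
qed

text \<open>The coordinate at \<open>\<alpha>\<close> to which the second letter of
  \<open>\<alpha> @ [x, y]\<close> is charged: a letter that could already follow
  \<open>\<alpha>\<close> keeps its own, a descendant of \<open>x\<close> is folded onto
  \<open>x\<close>.\<close>

definition label :: "'a list \<Rightarrow> 'a \<Rightarrow> 'a \<Rightarrow> 'a" where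
  "label \<alpha> x y = (if y \<in> C \<alpha> then y else x)"

text \<open>The linear map attached to the edge \<open>\<alpha> \<rightarrow> \<alpha>x\<close> of the combinatorial atlas; the coordinate
  \<^const>\<open>None\<close> is the paper's extra index \<open>null\<close>.\<close>

definition transport :: "'a list \<Rightarrow> 'a \<Rightarrow> ('a option \<Rightarrow> real) \<Rightarrow> 'a option \<Rightarrow> real" where
  "transport \<alpha> x v = case_option (v None) (\<lambda>y. v (Some (label \<alpha> x y)))"

definition row :: "nat \<Rightarrow> 'a list \<Rightarrow> ('a option \<Rightarrow> real) \<Rightarrow> real" where
  "row j \<alpha> v = B j \<alpha> * v None + (\<Sum>x\<in>X. B j (\<alpha> @ [x]) * v (Some x))"

text \<open>The matrix at \<open>\<alpha>\<close> applied to \<open>v\<close> has coordinate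
  \<open>row j \<alpha> v\<close> at \<open>None\<close>; its coordinate at \<open>Some x\<close> is
  the same functional at \<open>\<alpha> @ [x]\<close>, evaluated on the transported vector.\<close>

definition form :: "nat \<Rightarrow> 'a list \<Rightarrow> ('a option \<Rightarrow> real) \<Rightarrow> ('a option \<Rightarrow> real) \<Rightarrow> real" where
  "form j \<alpha> u v = u None * row j \<alpha> v + (\<Sum>x\<in>X. u (Some x) * row j (\<alpha> @ [x]) (transport \<alpha> x v))"

lemma transport_simps [simp]:
  "transport \<alpha> x v None = v None"
  "transport \<alpha> x v (Some y) = v (Some (label \<alpha> x y))"
  by (simp_all add: transport_def)

lemma row_outside: "\<alpha> \<notin> L \<Longrightarrow> row j \<alpha> v = 0"
  by (simp add: row_def B_outside B_outside_append)

lemma form_outside: "\<alpha> \<notin> L \<Longrightarrow> form j \<alpha> u v = 0"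
  by (simp add: form_def row_outside not_in_L_append)

lemma row_add: "row j \<alpha> (\<lambda>i. v i + r * w i) = row j \<alpha> v + r * row j \<alpha> w"
  by (simp add: row_def sum.distrib sum_distrib_left algebra_simps)

lemma row_transport:
  "row j (\<alpha> @ [x]) (transport \<alpha> x v)
    = B j (\<alpha> @ [x]) * v None + (\<Sum>y\<in>X. B j (\<alpha> @ [x, y]) * v (Some (label \<alpha> x y)))"
  by (simp add: row_def)

text \<open>If both letters continue \<open>\<alpha>\<close>, the label is \<open>y\<close>, and the
  terms for \<open>xy\<close> and \<open>yx\<close> cancel by \<open>B_swap\<close>. Otherwise the
  label is \<open>x\<close> or the word lies outside \<open>L\<close>.\<close>

lemma label_antisym:
  assumes "ContInv X L q \<alpha>"
  shows "(\<Sum>x\<in>X. \<Sum>y\<in>X. B j (\<alpha> @ [x, y]) * (f (label \<alpha> x y) - f x)) = 0"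
proof (rule sum_zero_by_swap)
  fix x y
  have out: "B j (\<alpha> @ [z, z']) = 0" if "z \<notin> C \<alpha>" for z z'
    using B_outside_append[of "\<alpha> @ [z]" j "[z']"] that by (simp add: mem_C)
  show "B j (\<alpha> @ [x, y]) * (f (label \<alpha> x y) - f x) + B j (\<alpha> @ [y, x]) * (f (label \<alpha> y x) - f y) = 0"
    using B_swap[OF assms, of x y "[]" j] out
    by (cases "x \<in> C \<alpha>"; cases "y \<in> C \<alpha>") (auto simp: label_def algebra_simps)
qed

text \<open>Splitting \<open>B (Suc j)\<close> by one more letter gives the right side with every
  label replaced by \<open>x\<close>; by \<open>label_antisym\<close> the replacement does not
  change the sum.\<close>

lemma row_Suc:
  assumes "ContInv X L q \<alpha>"
  shows "row (Suc j) \<alpha> v = (\<Sum>x\<in>X. row j (\<alpha> @ [x]) (transport \<alpha> x v))"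
proof -
  have "(\<Sum>x\<in>X. row j (\<alpha> @ [x]) (transport \<alpha> x v)) - row (Suc j) \<alpha> v
      = (\<Sum>x\<in>X. \<Sum>y\<in>X. B j (\<alpha> @ [x, y]) * (v (Some (label \<alpha> x y)) - v (Some x)))"
    by (simp add: row_transport row_def[of "Suc j"] sum.distrib sum_distrib_right
        right_diff_distrib sum_subtractf)
  then show ?thesis using label_antisym[OF assms, of j "\<lambda>x. v (Some x)"] by simp
qed

lemma form_commute:
  assumes "ContInv X L q \<alpha>"
  shows "form j \<alpha> u v = form j \<alpha> v u"
proof -
  let ?f = "\<lambda>x y. B j (\<alpha> @ [x, y]) *
    (u (Some x) * v (Some (label \<alpha> x y)) - v (Some x) * u (Some (label \<alpha> x y)))"
  have out: "B j (\<alpha> @ [z, z']) = 0" if "z \<notin> C \<alpha>" for z z'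
    using B_outside_append[of "\<alpha> @ [z]" j "[z']"] that by (simp add: mem_C)
  have "(\<Sum>x\<in>X. \<Sum>y\<in>X. ?f x y) = 0"
  proof (rule sum_zero_by_swap)
    fix x y
    show "?f x y + ?f y x = 0"
      using B_swap[OF assms, of x y "[]" j] out
      by (cases "x \<in> C \<alpha>"; cases "y \<in> C \<alpha>") (auto simp: label_def algebra_simps)
  qed
  moreover have "form j \<alpha> u v - form j \<alpha> v u = (\<Sum>x\<in>X. \<Sum>y\<in>X. ?f x y)"
    by (simp add: form_def row_transport row_def[of j \<alpha>] sum.distrib sum_distrib_left
        right_diff_distrib distrib_left sum_subtractf mult_ac)
  ultimately show ?thesis by simp
qed

text \<open>The vector \<open>h\<close> of the atlas, rescaled: the parameter \<open>t\<close> of the paper is \<open>1 / (1 + s)\<close>.\<close>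

definition hvec :: "real \<Rightarrow> 'a option \<Rightarrow> real" where
  "hvec s = case_option s (\<lambda>_. 1)"

lemma hvec_simps [simp]: "hvec s None = s" "hvec s (Some x) = 1"
  by (simp_all add: hvec_def)

lemma transport_hvec [simp]: "transport \<alpha> x (hvec s) = hvec s"
  by (auto simp: transport_def hvec_def fun_eq_iff split: option.split)

lemma row_hvec: "row j \<alpha> (hvec s) = s * B j \<alpha> + B (Suc j) \<alpha>"
  by (simp add: row_def)

text \<open>Relabelling letters does not affect \<open>hvec s\<close>, which is constant on them.
  Read from right to left, this turns coordinates of the perturbed matrix into values of the form
  with index \<open>j\<close>, where the induction hypothesis applies.\<close>

lemma form_hvec: "form j \<alpha> v (hvec s) = row (Suc j) \<alpha> v + s * row j \<alpha> v"
  unfolding form_def transport_hvec row_hvec row_def[of _ _ v]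
  by (simp only: distrib_left sum.distrib sum_distrib_left mult_ac add_ac)

lemma form_hvec_pos:
  assumes "\<alpha> \<in> L" "length \<alpha> + j \<le> greedoid_rk L" "0 < s"
  shows "0 < form j \<alpha> (hvec s) (hvec s)"
proof -
  have "0 < s * (s * B j \<alpha>)"
    using assms B_pos[OF assms(1,2)] by simp
  moreover have "0 \<le> s * B (Suc j) \<alpha>" "0 \<le> B (Suc (Suc j)) \<alpha>"
    using assms B_nonneg[of "Suc j" \<alpha>] B_nonneg[of "Suc (Suc j)" \<alpha>] by (auto simp del: cont_sum.simps)
  ultimately show ?thesis
    unfolding form_hvec row_hvec distrib_left by linarith
qed

end

locale weighted_interval_greedoid = weighted_greedoid X L q + interval_greedoid X L
  for X :: "'a set" and L :: "'a list set" and q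
begin

text \<open>Both sides are expanded over two further letters by \<open>row_Suc\<close>. In the
  difference the \<open>None\<close> part cancels by \<open>label_antisym\<close>, and the words
  \<open>xy\<close> and \<open>yx\<close> together contribute the square of \<open>g y - g x\<close>
  times the difference of the two sums in (PAMon).\<close>

lemma form_Suc_le_sum:
  assumes inv: "ContInv X L q \<alpha>" and inv': "\<And>x. x \<in> C \<alpha> \<Longrightarrow> ContInv X L q (\<alpha> @ [x])"
    and pamon: "PAMon X L q \<alpha>"
  shows "form (Suc j) \<alpha> w w \<le> (\<Sum>x\<in>X. form j (\<alpha> @ [x]) (transport \<alpha> x w) (transport \<alpha> x w))"
proof -
  define g where "g x = w (Some x)" for x
  define l where "l x y z = label \<alpha> x (label (\<alpha> @ [x]) y z)" for x y z
  define S where "S x y = (\<Sum>z\<in>X. B j (\<alpha> @ [x, y, z]) * g (l x y z))" for x y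
  define T where "T x y = row j (\<alpha> @ [x, y]) (transport (\<alpha> @ [x]) y (transport \<alpha> x w))" for x y
  have T: "T x y = B j (\<alpha> @ [x, y]) * w None + S x y" for x y
    using row_transport[of j "\<alpha> @ [x]" y "transport \<alpha> x w"]
    by (simp add: T_def S_def l_def g_def)
  have lhs: "row (Suc j) (\<alpha> @ [x]) (transport \<alpha> x w) = (\<Sum>y\<in>X. T x y)" for x
  proof (cases "x \<in> C \<alpha>")
    case True
    then show ?thesis using row_Suc[OF inv'] by (simp add: T_def)
  next
    case False
    then show ?thesis
      using not_in_L_append[of "\<alpha> @ [x]" "[_]"] by (simp add: T_def row_outside mem_C)
  qed
  have "(\<Sum>x\<in>X. form j (\<alpha> @ [x]) (transport \<alpha> x w) (transport \<alpha> x w)) - form (Suc j) \<alpha> w w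
      = (\<Sum>x\<in>X. \<Sum>y\<in>X. (g (label \<alpha> x y) - g x) * T x y)"
    by (simp add: form_def row_Suc[OF inv] lhs T_def g_def sum.distrib sum_distrib_left
        left_diff_distrib sum_subtractf)
  also have "\<dots> = w None * (\<Sum>x\<in>X. \<Sum>y\<in>X. B j (\<alpha> @ [x, y]) * (g (label \<alpha> x y) - g x))
      + (\<Sum>x\<in>X. \<Sum>y\<in>X. (g (label \<alpha> x y) - g x) * S x y)"
    by (simp add: T sum_distrib_left sum.distrib distrib_left mult_ac)
  also have "\<dots> = (\<Sum>x\<in>X. \<Sum>y\<in>X. (g (label \<alpha> x y) - g x) * S x y)"
    by (simp add: label_antisym[OF inv])
  also have "0 \<le> \<dots>"
  proof (rule sum_nonneg_by_swap)
    fix x y assume X: "x \<in> X" "y \<in> X"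
    have out: "S z z' = 0" if "z \<notin> C \<alpha>" for z z'
      unfolding S_def using B_outside_append[of "\<alpha> @ [z]" j "[z', _]"] that by (simp add: mem_C)
    consider "x \<notin> C \<alpha>" | "y \<notin> C \<alpha>" | "x = y" | "x \<in> C \<alpha>" "y \<in> C \<alpha>" "x \<noteq> y" by blast
    then show "0 \<le> (g (label \<alpha> x y) - g x) * S x y + (g (label \<alpha> y x) - g y) * S y x"
    proof cases
      case 4
      let ?b = "\<lambda>z. B j (\<alpha> @ [x, y, z])"
      \<comment> \<open>If \<open>z\<close> does not continue \<open>\<alpha>\<close>, then
        \<open>l x y z\<close> is \<open>x\<close> when \<open>z\<close> continues
        \<open>\<alpha> @ [x]\<close> and \<open>y\<close> otherwise. Hence the two orders differ
        exactly for passive \<open>z\<close>, with sign plus, and active \<open>z\<close>, with sign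
        minus.\<close>
      have diff: "?b z * g (l x y z) - B j (\<alpha> @ [y, x, z]) * g (l y x z)
          = (g y - g x) * ((if z \<in> pas X L \<alpha> x y then ?b z else 0)
            - (if z \<in> act X L \<alpha> x y then ?b z else 0))" if z: "z \<in> X" for z
      proof -
        have eq: "B j (\<alpha> @ [y, x, z]) = ?b z"
          using B_swap[OF inv 4(1,2), of "[z]" j] z by simp
        have "zero_ext L q (\<alpha> @ [x, y, z]) = zero_ext L q (\<alpha> @ [y, x, z])"
          using B_swap[OF inv 4(1,2), of "[z]" 0] z by simp
        then have L_iff: "\<alpha> @ [x, y, z] \<in> L \<longleftrightarrow> \<alpha> @ [y, x, z] \<in> L"
          using q_pos[of "\<alpha> @ [x, y, z]"] q_pos[of "\<alpha> @ [y, x, z]"]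
          by (auto simp: zero_ext_def split: if_splits)
        show ?thesis
        proof (cases "\<alpha> @ [x, y, z] \<in> L")
          case False
          then show ?thesis using L_iff by (simp add: B_outside)
        next
          case True
          have "\<alpha> \<in> lists X" using True L_words by auto
          \<comment> \<open>The interval property: a \<open>z\<close> that continues
            \<open>\<alpha>\<close> continues both intermediate words too, so its label is
            \<open>z\<close> in both orders.\<close>
          have "\<alpha> @ [x, z] \<in> L" "\<alpha> @ [y, z] \<in> L" if "\<alpha> @ [z] \<in> L"
            using interval[of \<alpha> "[x]" "[y]" z] interval[of \<alpha> "[y]" "[x]" z]
              True L_iff that X z \<open>\<alpha> \<in> lists X\<close> by auto
          moreover have "\<alpha> @ [x, y] \<in> L"
            using hereditary[of "\<alpha> @ [x, y]" "[z]"] True by simp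
          ultimately show ?thesis
            unfolding eq using 4 True z
            by (auto simp: l_def label_def mem_C pas_def act_def algebra_simps)
        qed
      qed
      have "S x y - S y x = (\<Sum>z\<in>X. (g y - g x) * ((if z \<in> pas X L \<alpha> x y then ?b z else 0)
            - (if z \<in> act X L \<alpha> x y then ?b z else 0)))"
        unfolding S_def sum_subtractf[symmetric] by (intro sum.cong refl diff)
      also have "\<dots> = (g y - g x) * ((\<Sum>z\<in>X. if z \<in> pas X L \<alpha> x y then ?b z else 0)
            - (\<Sum>z\<in>X. if z \<in> act X L \<alpha> x y then ?b z else 0))"
        by (simp only: sum_distrib_left[symmetric] sum_subtractf)
      also have "\<dots> = (g y - g x) * ((\<Sum>z\<in>pas X L \<alpha> x y. ?b z) - (\<Sum>z\<in>act X L \<alpha> x y. ?b z))"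
      proof -
        have "X \<inter> pas X L \<alpha> x y = pas X L \<alpha> x y" "X \<inter> act X L \<alpha> x y = act X L \<alpha> x y"
          by (auto simp: pas_def act_def)
        then show ?thesis by (simp add: sum.inter_restrict[OF finite_X, symmetric])
      qed
      finally have d: "S x y - S y x = \<dots>" .
      have "(g y - g x) * S x y + (g x - g y) * S y x = (g y - g x) * (S x y - S y x)"
        by (simp add: algebra_simps)
      also have "\<dots> = (g y - g x)\<^sup>2 * ((\<Sum>z\<in>pas X L \<alpha> x y. ?b z) - (\<Sum>z\<in>act X L \<alpha> x y. ?b z))"
        by (simp add: d power2_eq_square)
      finally have "(g y - g x) * S x y + (g x - g y) * S y x = \<dots>" .
      moreover have "(\<Sum>z\<in>act X L \<alpha> x y. ?b z) \<le> (\<Sum>z\<in>pas X L \<alpha> x y. ?b z)"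
      proof -
        have "?b z = (\<Sum>\<beta>\<in>cont_words X L j (\<alpha> @ [x, y, z]). zero_ext L q (\<alpha> @ [x, y, z] @ \<beta>))" for z
          using sum_cont_words[of q "\<alpha> @ [x, y, z]" j] by simp
        then show ?thesis using pamon 4 by (simp add: PAMon_def)
      qed
      ultimately show ?thesis using 4 by (simp add: label_def)
    qed (auto simp: out label_def)
  qed
  finally show ?thesis by simp
qed

end

section \<open>The induction step\<close>

lemma sum_insert_None:
  "finite A \<Longrightarrow> sum f (insert None (Some ` A)) = f None + (\<Sum>x\<in>A. f (Some x))"
  by (simp add: sum.reindex)

lemma matrix_form_indicator:
  assumes "finite S" "a \<in> S" "b \<in> S"
  shows "matrix_form S M (\<lambda>i. if i = a then 1 else 0) (\<lambda>i. if i = b then 1 else 0) = M a b"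
  using assms by (simp add: matrix_form_def if_distrib[of "\<lambda>t. _ * t"] if_distrib[of "\<lambda>t. t * _"] cong: if_cong)

section \<open>The matrix of the form and its nonzero rows\<close>

context weighted_greedoid
begin

text \<open>For distinct \<open>x\<close> and \<open>y\<close> in \<open>C \<alpha>\<close> the
  letter entry is \<open>B j (\<alpha> @ [x, y])\<close>; the diagonal entry collects the
  descendants of \<open>x\<close>.\<close>

definition entry :: "nat \<Rightarrow> 'a list \<Rightarrow> 'a option \<Rightarrow> 'a option \<Rightarrow> real" where
  "entry j \<alpha> a b = (case a of
      None \<Rightarrow> (case b of None \<Rightarrow> B j \<alpha> | Some y \<Rightarrow> B j (\<alpha> @ [y]))
    | Some x \<Rightarrow> (case b of None \<Rightarrow> B j (\<alpha> @ [x])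
        | Some y \<Rightarrow> (\<Sum>z | z \<in> X \<and> label \<alpha> x z = y. B j (\<alpha> @ [x, z]))))"

text \<open>Letters outside \<open>C \<alpha>\<close> have zero rows, whereas the spectral argument
  divides by the \<open>(M h)_i\<close> and needs a positive column.\<close>

definition support :: "'a list \<Rightarrow> 'a option set" where
  "support \<alpha> = insert None (Some ` C \<alpha>)"

lemma finite_support: "finite (support \<alpha>)"
  by (simp add: support_def finite_C)

lemma entry_nonneg: "0 \<le> entry j \<alpha> a b"
  by (auto simp: entry_def B_nonneg intro!: sum_nonneg split: option.split)

lemma sum_entry_None:
  "(\<Sum>b\<in>insert None (Some ` X). entry j \<alpha> None b * v b) = row j \<alpha> v"
  unfolding sum_insert_None[OF finite_X] by (simp add: entry_def row_def)

lemma sum_entry_Some: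
  assumes "x \<in> X"
  shows "(\<Sum>b\<in>insert None (Some ` X). entry j \<alpha> (Some x) b * v b) = row j (\<alpha> @ [x]) (transport \<alpha> x v)"
proof -
  have "(\<Sum>y\<in>X. (\<Sum>z | z \<in> X \<and> label \<alpha> x z = y. B j (\<alpha> @ [x, z])) * v (Some y))
      = (\<Sum>y\<in>X. \<Sum>z | z \<in> X \<and> label \<alpha> x z = y. B j (\<alpha> @ [x, z]) * v (Some (label \<alpha> x z)))"
    by (intro sum.cong refl) (simp add: sum_distrib_right)
  also have "\<dots> = (\<Sum>z\<in>X. B j (\<alpha> @ [x, z]) * v (Some (label \<alpha> x z)))"
    using assms by (intro sum.group) (auto simp: finite_X label_def)
  finally show ?thesis
    unfolding sum_insert_None[OF finite_X] by (simp add: entry_def row_transport)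
qed

lemma form_eq_matrix_form:
  "form j \<alpha> u v = matrix_form (insert None (Some ` X)) (entry j \<alpha>) u v"
  unfolding matrix_form_def
  by (subst sum_insert_None[OF finite_X]) (simp add: form_def sum_entry_None sum_entry_Some)

lemma entry_commute:
  assumes "ContInv X L q \<alpha>" "a \<in> insert None (Some ` X)" "b \<in> insert None (Some ` X)"
  shows "entry j \<alpha> a b = entry j \<alpha> b a"
proof -
  have fin: "finite (insert None (Some ` X))" using finite_X by simp
  show ?thesis
    using form_commute[OF assms(1), of j "\<lambda>i. if i = a then 1 else 0" "\<lambda>i. if i = b then 1 else 0"]
    unfolding form_eq_matrix_form matrix_form_indicator[OF fin assms(2,3)]
      matrix_form_indicator[OF fin assms(3,2)] .
qed

lemma support_subset: "support \<alpha> \<subseteq> insert None (Some ` X)"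
  using C_subset by (auto simp: support_def)

lemma entry_outside:
  assumes "a \<in> insert None (Some ` X) - support \<alpha>"
  shows "entry j \<alpha> a b = 0"
proof -
  obtain x where "a = Some x" "\<alpha> @ [x] \<notin> L"
    using assms by (auto simp: support_def image_iff mem_C)
  then show ?thesis
    using B_outside B_outside_append[of "\<alpha> @ [x]" j "[_]"] by (auto simp: entry_def split: option.split)
qed

lemma sum_entry_support:
  assumes "ContInv X L q \<alpha>" "a \<in> insert None (Some ` X)"
  shows "(\<Sum>b\<in>support \<alpha>. entry j \<alpha> a b * v b) = (\<Sum>b\<in>insert None (Some ` X). entry j \<alpha> a b * v b)"
proof (rule sum.mono_neutral_left)
  show "finite (insert None (Some ` X))" using finite_X by simp
  show "\<forall>b\<in>insert None (Some ` X) - support \<alpha>. entry j \<alpha> a b * v b = 0"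
    using entry_commute[OF assms] entry_outside by (metis DiffD1 mult_zero_left)
qed (rule support_subset)

lemma form_eq_matrix_form_support:
  assumes "ContInv X L q \<alpha>"
  shows "form j \<alpha> u v = matrix_form (support \<alpha>) (entry j \<alpha>) u v"
proof -
  have "form j \<alpha> u v = (\<Sum>a\<in>support \<alpha>. u a * (\<Sum>b\<in>insert None (Some ` X). entry j \<alpha> a b * v b))"
    unfolding form_eq_matrix_form matrix_form_def
    by (rule sum.mono_neutral_right)
      (simp_all add: entry_outside finite_X support_subset del: insert_iff Diff_iff)
  also have "\<dots> = matrix_form (support \<alpha>) (entry j \<alpha>) u v"
    unfolding matrix_form_def using support_subset
    by (intro sum.cong refl) (metis sum_entry_support[OF assms] subsetD)
  finally show ?thesis .
qed

end

context weighted_interval_greedoid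
begin

text \<open>For \<open>s = 0\<close> the vector \<open>h\<close> vanishes at \<^const>\<open>None\<close>, so the spectral argument needs \<open>s > 0\<close>.\<close>

lemma hyperbolic_perturbed:
  assumes inv: "ContInv X L q \<alpha>" and inv': "\<And>x. x \<in> C \<alpha> \<Longrightarrow> ContInv X L q (\<alpha> @ [x])"
    and pamon: "PAMon X L q \<alpha>"
    and \<alpha>: "\<alpha> \<in> L" "length \<alpha> + j < greedoid_rk L" and s: "0 < s"
    and hyp: "hyperbolic (form j \<alpha>)"
    and hyp': "\<And>x. x \<in> C \<alpha> \<Longrightarrow> hyperbolic (form j (\<alpha> @ [x]))"
  shows "hyperbolic (\<lambda>u v. form (Suc j) \<alpha> u v + s * form j \<alpha> u v)" (is "hyperbolic ?G")
proof -
  define M where "M a b = entry (Suc j) \<alpha> a b + s * entry j \<alpha> a b" for a b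
  define S where "S = support \<alpha>"
  have G: "?G u v = matrix_form S M u v" for u v
    unfolding form_eq_matrix_form_support[OF inv] S_def[symmetric] M_def matrix_form_def
    by (simp add: sum.distrib sum_distrib_left algebra_simps)
  have M_commute: "M a b = M b a" if "a \<in> S" "b \<in> S" for a b
  proof -
    have "a \<in> insert None (Some ` X)" "b \<in> insert None (Some ` X)"
      using that support_subset unfolding S_def by blast+
    then show ?thesis
      using entry_commute[OF inv, of a b j] entry_commute[OF inv, of a b "Suc j"] unfolding M_def by metis
  qed
  have row_M: "(\<Sum>b\<in>S. M a b * v b) = (\<Sum>b\<in>insert None (Some ` X). entry (Suc j) \<alpha> a b * v b)
      + s * (\<Sum>b\<in>insert None (Some ` X). entry j \<alpha> a b * v b)" if "a \<in> S" for a v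
  proof -
    have a: "a \<in> insert None (Some ` X)" using that support_subset unfolding S_def by blast
    show ?thesis
      unfolding sum_entry_support[OF inv a, symmetric] S_def M_def
      by (simp add: sum.distrib sum_distrib_left algebra_simps)
  qed
  \<comment> \<open>The summand with factor \<open>s\<close> was added so that
    \<open>form_hvec\<close> applies to every coordinate of \<open>M v\<close>.\<close>
  have M_None: "(\<Sum>b\<in>S. M None b * v b) = form j \<alpha> v (hvec s)" for v
    using row_M[of None v] unfolding sum_entry_None form_hvec by (simp add: S_def support_def)
  have M_Some: "(\<Sum>b\<in>S. M (Some x) b * v b) = form j (\<alpha> @ [x]) (transport \<alpha> x v) (hvec s)"
    if "x \<in> C \<alpha>" for x v
  proof -
    have "x \<in> X" using that C_subset by auto
    then show ?thesis
      using row_M[of "Some x" v] that unfolding sum_entry_Some[OF \<open>x \<in> X\<close>] form_hvec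
      by (simp add: S_def support_def)
  qed
  have sum_S: "(\<Sum>a\<in>S. f a) = f None + (\<Sum>x\<in>C \<alpha>. f (Some x))" for f :: "'a option \<Rightarrow> real"
    unfolding S_def support_def by (rule sum_insert_None[OF finite_C])
  have pos_None: "0 < form j \<alpha> (hvec s) (hvec s)"
    using \<alpha> s by (intro form_hvec_pos) auto
  have pos_Some: "0 < form j (\<alpha> @ [x]) (hvec s) (hvec s)" if "x \<in> C \<alpha>" for x
    using \<alpha> s that by (intro form_hvec_pos) (auto simp: mem_C)
  have neg: "?G z z \<le> 0" if "matrix_form S M z (hvec s) = 0" for z
    unfolding G
  proof (rule matrix_form_nonpos_on_complement[where h = "hvec s" and p = None])
    show "finite S" "None \<in> S"
      by (simp_all add: S_def finite_support) (simp add: support_def)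
    show "M a b = M b a" if "a \<in> S" "b \<in> S" for a b
      using that by (rule M_commute)
    show "0 \<le> M a b" for a b
      using s entry_nonneg by (simp add: M_def)
    show "0 < hvec s a" for a
      using s by (cases a) auto
    \<comment> \<open>At \<open>\<alpha> @ [x]\<close> the summand with \<open>Suc j\<close> may
      vanish, as the words can exceed the rank. The summand with factor \<open>s\<close> is
      positive.\<close>
    show "0 < M a None" if "a \<in> S" for a
    proof -
      obtain \<beta> where \<beta>: "\<beta> \<in> L" "length \<beta> + j \<le> greedoid_rk L" "entry i \<alpha> a None = B i \<beta>" for i
      proof (cases a)
        case None
        then show thesis using that[of \<alpha>] \<alpha> by (simp add: entry_def)
      next
        case (Some x)
        then show thesis using that[of "\<alpha> @ [x]"] \<alpha> \<open>a \<in> S\<close>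
          by (auto simp: entry_def S_def support_def mem_C)
      qed
      show ?thesis
        unfolding M_def \<beta>(3) using s B_pos[OF \<beta>(1,2)] B_nonneg[of "Suc j" \<beta>]
        by (intro add_nonneg_pos) auto
    qed
    show "matrix_form S M v v \<le> (\<Sum>a\<in>S. hvec s a / (\<Sum>b\<in>S. M a b * hvec s b) * (\<Sum>b\<in>S. M a b * v b)\<^sup>2)" for v
    proof -
      have div: "F v v \<le> 1 / F h h * (F v h)\<^sup>2" if "hyperbolic F" "0 < F h h" for F and v h :: "'a option \<Rightarrow> real"
        using that by (simp add: hyperbolic_def pos_le_divide_eq)
      have "?G v v \<le> (\<Sum>x\<in>X. form j (\<alpha> @ [x]) (transport \<alpha> x v) (transport \<alpha> x v)) + s * form j \<alpha> v v"
        using form_Suc_le_sum[OF inv inv' pamon] by simp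
      also have "(\<Sum>x\<in>X. form j (\<alpha> @ [x]) (transport \<alpha> x v) (transport \<alpha> x v))
          = (\<Sum>x\<in>C \<alpha>. form j (\<alpha> @ [x]) (transport \<alpha> x v) (transport \<alpha> x v))"
        using finite_X C_subset by (intro sum.mono_neutral_right) (auto simp: form_outside mem_C)
      also have "\<dots> \<le> (\<Sum>x\<in>C \<alpha>. 1 / form j (\<alpha> @ [x]) (hvec s) (hvec s)
          * (form j (\<alpha> @ [x]) (transport \<alpha> x v) (hvec s))\<^sup>2)"
      proof (rule sum_mono)
        fix x assume x: "x \<in> C \<alpha>"
        from div[OF hyp'[OF x] pos_Some[OF x]]
        show "form j (\<alpha> @ [x]) (transport \<alpha> x v) (transport \<alpha> x v)
          \<le> 1 / form j (\<alpha> @ [x]) (hvec s) (hvec s) * (form j (\<alpha> @ [x]) (transport \<alpha> x v) (hvec s))\<^sup>2" .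
      qed
      \<comment> \<open>The factor \<open>s\<close> equals \<open>hvec s None\<close>, so this
        becomes the summand at \<open>None\<close> of the required bound.\<close>
      also have "s * form j \<alpha> v v \<le> s * (1 / form j \<alpha> (hvec s) (hvec s) * (form j \<alpha> v (hvec s))\<^sup>2)"
        using s by (intro mult_left_mono div[OF hyp pos_None]) auto
      also have "(\<Sum>x\<in>C \<alpha>. 1 / form j (\<alpha> @ [x]) (hvec s) (hvec s) * (form j (\<alpha> @ [x]) (transport \<alpha> x v) (hvec s))\<^sup>2)
          + s * (1 / form j \<alpha> (hvec s) (hvec s) * (form j \<alpha> v (hvec s))\<^sup>2)
          = (\<Sum>a\<in>S. hvec s a / (\<Sum>b\<in>S. M a b * hvec s b) * (\<Sum>b\<in>S. M a b * v b)\<^sup>2)"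
        by (subst sum_S) (simp add: M_None M_Some)
      finally show ?thesis unfolding G by simp
    qed
  qed (fact that)
  show ?thesis
  proof (rule hyperbolicI[where l = "\<lambda>z. matrix_form S M z (hvec s)"])
    show "matrix_form S M (\<lambda>i. x i + r * y i) (hvec s)
        = matrix_form S M x (hvec s) + r * matrix_form S M y (hvec s)" for x y r
      by (rule matrix_form_add_left)
    show "?G (\<lambda>i. x i + r * y i) (\<lambda>i. x i + r * y i) = ?G x x + 2 * r * ?G x y + r\<^sup>2 * ?G y y" for x y r
      unfolding G matrix_form_add_left matrix_form_add_right
      using matrix_form_commute[of S M y x, OF M_commute] by (simp add: algebra_simps power2_eq_square)
  qed (rule neg)
qed

text \<open>For small \<open>s > 0\<close> the perturbed form is still positive at \<open>y\<close>,
  and the inequality survives the limit \<open>s\<close> to 0.\<close>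

lemma hyperbolic_Suc:
  assumes "ContInv X L q \<alpha>" "\<And>x. x \<in> C \<alpha> \<Longrightarrow> ContInv X L q (\<alpha> @ [x])" "PAMon X L q \<alpha>"
    and "\<alpha> \<in> L" "length \<alpha> + j < greedoid_rk L"
    and "hyperbolic (form j \<alpha>)" "\<And>x. x \<in> C \<alpha> \<Longrightarrow> hyperbolic (form j (\<alpha> @ [x]))"
  shows "hyperbolic (form (Suc j) \<alpha>)"
  unfolding hyperbolic_def
proof (intro allI impI)
  fix x y assume pos: "0 < form (Suc j) \<alpha> y y"
  define G where "G s u v = form (Suc j) \<alpha> u v + s * form j \<alpha> u v" for s u v
  have G: "((\<lambda>s. G s u v) \<longlongrightarrow> form (Suc j) \<alpha> u v) (at_right 0)" for u v
    unfolding G_def by (auto intro!: tendsto_eq_intros)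
  have "eventually (\<lambda>s. 0 < G s y y) (at_right 0)"
    using order_tendstoD(1)[OF G pos] .
  moreover have "eventually (\<lambda>s::real. 0 < s) (at_right 0)"
    by (rule eventually_at_right_less)
  ultimately have "eventually (\<lambda>s. G s x x * G s y y \<le> (G s x y)\<^sup>2) (at_right 0)"
  proof eventually_elim
    case (elim s)
    have "hyperbolic (G s)"
      unfolding G_def by (rule hyperbolic_perturbed) (fact assms | rule elim)+
    then show ?case using elim by (simp add: hyperbolic_def)
  qed
  then show "form (Suc j) \<alpha> x x * form (Suc j) \<alpha> y y \<le> (form (Suc j) \<alpha> x y)\<^sup>2"
    by (intro tendsto_le[OF _ tendsto_power[OF G] tendsto_mult[OF G G]]) auto
qed

end

section \<open>The base case and the theorem\<close>

lemma (in greedoid) sum_par: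
  "(\<Sum>x\<in>cont X L \<alpha>. f x) = (\<Sum>K\<in>par X L \<alpha>. \<Sum>x\<in>K. f x)"
proof -
  have fin: "finite (cont X L \<alpha>)"
    using finite_X by (rule rev_finite_subset) (auto simp: cont_def cont_words_def)
  have "sum f (\<Union>(par X L \<alpha>)) = (sum \<circ> sum) f (par X L \<alpha>)"
  proof (rule sum.Union_disjoint)
    show "\<forall>K\<in>par X L \<alpha>. finite K"
      using finite_equiv_class[OF fin, of "par_rel X L \<alpha>"] equiv_par_rel[of \<alpha>]
      by (auto simp: par_def par_rel_def)
    show "\<forall>K\<in>par X L \<alpha>. \<forall>K'\<in>par X L \<alpha>. K \<noteq> K' \<longrightarrow> K \<inter> K' = {}"
      using quotient_disj[OF equiv_par_rel] unfolding par_def by blast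
  qed
  then show ?thesis
    using Union_quotient[OF equiv_par_rel] by (simp add: par_def)
qed

context weighted_greedoid
begin

lemma form_add_self:
  assumes "ContInv X L q \<alpha>"
  shows "form j \<alpha> (\<lambda>i. x i + r * y i) (\<lambda>i. x i + r * y i)
    = form j \<alpha> x x + 2 * r * form j \<alpha> x y + r\<^sup>2 * form j \<alpha> y y"
  using form_commute[OF assms, of j x y]
  unfolding form_eq_matrix_form matrix_form_add_left matrix_form_add_right
  by (simp add: algebra_simps power2_eq_square)

text \<open>The hyperplane is the complement of the indicator of \<open>None\<close>. On it
  \<open>z None\<close> is determined by \<open>P\<close>, and the form becomes a multiple of the
  square of \<open>P\<close> minus the class sum \<open>E\<close>, up to positive factors.
  (ScaleMon) compares the two.\<close>

lemma form_0_nonpos: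
  assumes c: "0 < c (length \<alpha>)" "0 < c (length \<alpha> + 1)" "0 < c (length \<alpha> + 2)" and \<alpha>: "\<alpha> \<in> L"
    and logmod: "LogMod X L (scaled L q c) \<alpha>" and fewdes: "FewDes X L \<alpha>"
    and synmon: "SynMon X L (scaled L q c) \<alpha>"
    and scalemon: "ScaleMon X L (scaled L q c) c \<alpha>"
    and z: "row 0 \<alpha> z = 0"
  shows "form 0 \<alpha> z z \<le> 0"
proof -
  define \<omega> where "\<omega> = scaled L q c"
  define c0 c1 c2 where "c0 = c (length \<alpha>)" and "c1 = c (length \<alpha> + 1)" and "c2 = c (length \<alpha> + 2)"
  define g where "g x = z (Some x)" for x
  define p where "p x = \<omega> (\<alpha> @ [x]) * g x" for x
  define P where "P = (\<Sum>x\<in>C \<alpha>. p x)"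
  define b where "b x = (\<Sum>y\<in>des X L \<alpha> x. \<omega> \<alpha> * \<omega> (\<alpha> @ [x, y]) / (\<omega> (\<alpha> @ [x]))\<^sup>2)" for x
  define e where "e K = 1 - class_b X L \<omega> \<alpha> K" for K
  have c_pos: "0 < c0" "0 < c1" "0 < c2" using c by (simp_all add: c0_def c1_def c2_def)
  have \<omega>0: "0 < \<omega> \<alpha>"
    using \<alpha> q_pos c_pos by (simp add: \<omega>_def scaled_def zero_ext_def c0_def)
  have \<omega>1: "0 < \<omega> (\<alpha> @ [x])" if "x \<in> C \<alpha>" for x
    using that q_pos c_pos by (simp add: \<omega>_def scaled_def zero_ext_def c1_def mem_C)
  have \<omega>1_out: "\<omega> (\<alpha> @ [x]) = 0" if "x \<notin> C \<alpha>" for x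
    using that by (simp add: \<omega>_def scaled_def zero_ext_def mem_C)
  have \<omega>2_out: "\<omega> (\<alpha> @ [x, y]) = 0" if "\<alpha> @ [x, y] \<notin> L" for x y
    using that by (simp add: \<omega>_def scaled_def zero_ext_def)
  have B0: "B 0 \<alpha> = c0 * \<omega> \<alpha>" "B 0 (\<alpha> @ [x]) = c1 * \<omega> (\<alpha> @ [x])"
    "B 0 (\<alpha> @ [x, y]) = c2 * \<omega> (\<alpha> @ [x, y])" for x y
    using c_pos by (simp_all add: \<omega>_def scaled_def c0_def c1_def c2_def numeral_2_eq_2)
  have P_X: "(\<Sum>x\<in>X. \<omega> (\<alpha> @ [x]) * g x) = P"
    unfolding P_def p_def using finite_X C_subset by (intro sum.mono_neutral_right) (auto simp: \<omega>1_out)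
  have row_eq: "c0 * \<omega> \<alpha> * z None + c1 * P = 0"
    using z unfolding row_def B0 P_X[symmetric] g_def[symmetric] by (simp add: sum_distrib_left mult.assoc)
  \<comment> \<open>A letter \<open>y\<close> in \<open>C \<alpha>\<close> contributes
    \<open>p x * p y\<close> by (LogMod) unless it is parallel to \<open>x\<close>, when it
    contributes 0; this explains the subtracted class. Descendants of \<open>x\<close> carry the
    label \<open>x\<close> and give the term with \<open>b x\<close>.\<close>
  have inner: "\<omega> \<alpha> * (g x * (\<Sum>y\<in>X. \<omega> (\<alpha> @ [x, y]) * g (label \<alpha> x y)))
      = p x * P - p x * (\<Sum>y\<in>par_rel X L \<alpha> `` {x}. p y) + b x * (p x)\<^sup>2" if x: "x \<in> C \<alpha>" for x
  proof -
    have "(\<Sum>y\<in>X. \<omega> (\<alpha> @ [x, y]) * g (label \<alpha> x y))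
        = (\<Sum>y\<in>C \<alpha>. \<omega> (\<alpha> @ [x, y]) * g (label \<alpha> x y)) + (\<Sum>y\<in>X - C \<alpha>. \<omega> (\<alpha> @ [x, y]) * g (label \<alpha> x y))"
      using sum.subset_diff[OF C_subset finite_X] by (simp add: add.commute)
    also have "(\<Sum>y\<in>C \<alpha>. \<omega> (\<alpha> @ [x, y]) * g (label \<alpha> x y)) = (\<Sum>y\<in>C \<alpha>. \<omega> (\<alpha> @ [x, y]) * g y)"
      by (simp add: label_def)
    also have "(\<Sum>y\<in>X - C \<alpha>. \<omega> (\<alpha> @ [x, y]) * g (label \<alpha> x y)) = (\<Sum>y\<in>des X L \<alpha> x. \<omega> (\<alpha> @ [x, y]) * g x)"
      using finite_X by (intro sum.mono_neutral_cong_right) (auto simp: des_def mem_C label_def, metis \<omega>2_out)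
    finally have "\<omega> \<alpha> * (g x * (\<Sum>y\<in>X. \<omega> (\<alpha> @ [x, y]) * g (label \<alpha> x y)))
        = (\<Sum>y\<in>C \<alpha>. \<omega> \<alpha> * \<omega> (\<alpha> @ [x, y]) * g x * g y) + (\<Sum>y\<in>des X L \<alpha> x. \<omega> \<alpha> * \<omega> (\<alpha> @ [x, y]) * (g x)\<^sup>2)"
      by (simp add: sum_distrib_left distrib_left power2_eq_square mult_ac)
    also have "(\<Sum>y\<in>des X L \<alpha> x. \<omega> \<alpha> * \<omega> (\<alpha> @ [x, y]) * (g x)\<^sup>2) = b x * (p x)\<^sup>2"
      unfolding b_def p_def sum_distrib_right using \<omega>1[OF x]
      by (intro sum.cong refl) (simp add: power_mult_distrib)
    also have "(\<Sum>y\<in>C \<alpha>. \<omega> \<alpha> * \<omega> (\<alpha> @ [x, y]) * g x * g y)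
        = (\<Sum>y\<in>C \<alpha>. p x * p y - (if y \<in> par_rel X L \<alpha> `` {x} then p x * p y else 0))"
    proof (intro sum.cong refl)
      fix y assume y: "y \<in> C \<alpha>"
      show "\<omega> \<alpha> * \<omega> (\<alpha> @ [x, y]) * g x * g y
          = p x * p y - (if y \<in> par_rel X L \<alpha> `` {x} then p x * p y else 0)"
      proof (cases "\<alpha> @ [x, y] \<in> L")
        case True
        then have "\<omega> \<alpha> * \<omega> (\<alpha> @ [x, y]) = \<omega> (\<alpha> @ [x]) * \<omega> (\<alpha> @ [y])"
          using logmod x y by (simp add: LogMod_def \<omega>_def)
        then show ?thesis using True by (simp add: p_def par_rel_def mult_ac)
      next
        case False
        then show ?thesis using x y by (simp add: \<omega>2_out par_rel_def)
      qed
    qed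
    also have "\<dots> = p x * P - (\<Sum>y\<in>C \<alpha>. if y \<in> par_rel X L \<alpha> `` {x} then p x * p y else 0)"
      by (simp only: sum_subtractf P_def sum_distrib_left)
    also have "(\<Sum>y\<in>C \<alpha>. if y \<in> par_rel X L \<alpha> `` {x} then p x * p y else 0)
        = p x * (\<Sum>y\<in>par_rel X L \<alpha> `` {x}. p y)"
    proof -
      have "C \<alpha> \<inter> par_rel X L \<alpha> `` {x} = par_rel X L \<alpha> `` {x}" by (auto simp: par_rel_def)
      then show ?thesis
        by (simp only: sum.inter_restrict[OF finite_C, symmetric] sum_distrib_left)
    qed
    finally show ?thesis .
  qed
  \<comment> \<open>By (FewDes) descendants occur only for singleton classes, where the sum of
    \<open>b x\<close> times the square of \<open>p x\<close> is a multiple of the squared class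
    sum. (SynMon) gives \<open>0 \<le> e K\<close>.\<close>
  have class_eq: "(\<Sum>x\<in>K. p x * (\<Sum>y\<in>par_rel X L \<alpha> `` {x}. p y) - b x * (p x)\<^sup>2) = e K * (\<Sum>x\<in>K. p x)\<^sup>2"
    and e_nonneg: "0 \<le> e K" if K: "K \<in> par X L \<alpha>" for K
  proof -
    have K_sub: "K \<subseteq> C \<alpha>"
      using K in_quotient_imp_subset[OF equiv_par_rel] unfolding par_def by blast
    have K_class: "par_rel X L \<alpha> `` {x} = K" if "x \<in> K" for x
      using K that unfolding par_def quotient_def
      using equiv_class_eq[OF equiv_par_rel] by blast
    have K_ne: "K \<noteq> {}"
      using K in_quotient_imp_non_empty[OF equiv_par_rel] unfolding par_def by blast
    have "(\<Sum>x\<in>K. b x * (p x)\<^sup>2) = class_b X L \<omega> \<alpha> K * (\<Sum>x\<in>K. p x)\<^sup>2 \<and> class_b X L \<omega> \<alpha> K \<le> 1"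
    proof (cases "is_singleton K")
      case True
      then obtain x where x: "K = {x}" by (auto simp: is_singleton_def)
      then have "x \<in> C \<alpha>" using K_sub by simp
      have "b x = (\<Sum>y\<in>des X L \<alpha> x. \<omega> \<alpha> * \<omega> (\<alpha> @ [x, y])) / (\<omega> (\<alpha> @ [x]))\<^sup>2"
        unfolding b_def by (rule sum_divide_distrib[symmetric])
      also have "\<dots> \<le> 1"
        using synmon \<open>x \<in> C \<alpha>\<close> \<omega>1[OF \<open>x \<in> C \<alpha>\<close>] by (simp add: SynMon_def \<omega>_def[symmetric])
      finally show ?thesis by (simp add: class_b_def x b_def)
    next
      case False
      then have "card K \<noteq> 1" "card K \<noteq> 0"
        using K_ne K_sub finite_C[of \<alpha>] by (auto simp: is_singleton_altdef finite_subset)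
      then have "card K \<ge> 2" by linarith
      then have "des X L \<alpha> x = {}" if "x \<in> K" for x
        using fewdes K that by (simp add: FewDes_def)
      then show ?thesis using False by (simp add: class_b_def b_def)
    qed
    moreover have "(\<Sum>x\<in>K. p x * (\<Sum>y\<in>par_rel X L \<alpha> `` {x}. p y)) = (\<Sum>x\<in>K. p x)\<^sup>2"
      by (simp add: K_class power2_eq_square sum_distrib_right cong: sum.cong)
    ultimately show "(\<Sum>x\<in>K. p x * (\<Sum>y\<in>par_rel X L \<alpha> `` {x}. p y) - b x * (p x)\<^sup>2) = e K * (\<Sum>x\<in>K. p x)\<^sup>2"
      and "0 \<le> e K"
      by (simp_all add: e_def sum_subtractf left_diff_distrib)
  qed
  define E where "E = (\<Sum>K\<in>par X L \<alpha>. e K * (\<Sum>x\<in>K. p x)\<^sup>2)"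
  have E: "E = (\<Sum>x\<in>C \<alpha>. p x * (\<Sum>y\<in>par_rel X L \<alpha> `` {x}. p y) - b x * (p x)\<^sup>2)"
    unfolding sum_par E_def by (simp add: class_eq)
  have E_nonneg: "0 \<le> E" unfolding E_def using e_nonneg by (intro sum_nonneg) simp
  have "form 0 \<alpha> z z = z None * row 0 \<alpha> z + (\<Sum>x\<in>X. g x * (c1 * \<omega> (\<alpha> @ [x]) * z None
      + (\<Sum>y\<in>X. c2 * \<omega> (\<alpha> @ [x, y]) * g (label \<alpha> x y))))"
    unfolding form_def row_transport B0 g_def ..
  also have "\<dots> = c1 * z None * (\<Sum>x\<in>X. \<omega> (\<alpha> @ [x]) * g x)
      + c2 * (\<Sum>x\<in>X. g x * (\<Sum>y\<in>X. \<omega> (\<alpha> @ [x, y]) * g (label \<alpha> x y)))"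
    unfolding z by (simp add: sum.distrib distrib_left sum_distrib_left mult_ac)
  also have "(\<Sum>x\<in>X. g x * (\<Sum>y\<in>X. \<omega> (\<alpha> @ [x, y]) * g (label \<alpha> x y)))
      = (\<Sum>x\<in>C \<alpha>. g x * (\<Sum>y\<in>X. \<omega> (\<alpha> @ [x, y]) * g (label \<alpha> x y)))"
  proof (rule sum.mono_neutral_right[OF finite_X C_subset], intro ballI)
    fix x assume "x \<in> X - C \<alpha>"
    then have "\<alpha> @ [x, y] \<notin> L" for y
      using not_in_L_append[of "\<alpha> @ [x]" "[y]"] by (simp add: mem_C)
    then show "g x * (\<Sum>y\<in>X. \<omega> (\<alpha> @ [x, y]) * g (label \<alpha> x y)) = 0"
      by (simp add: \<omega>2_out)
  qed
  finally have "\<omega> \<alpha> * form 0 \<alpha> z z = c1 * (\<omega> \<alpha> * z None) * P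
      + c2 * (\<Sum>x\<in>C \<alpha>. \<omega> \<alpha> * (g x * (\<Sum>y\<in>X. \<omega> (\<alpha> @ [x, y]) * g (label \<alpha> x y))))"
    unfolding P_X sum_distrib_left[of "\<omega> \<alpha>" _ "C \<alpha>", symmetric] by (simp add: algebra_simps)
  also have "(\<Sum>x\<in>C \<alpha>. \<omega> \<alpha> * (g x * (\<Sum>y\<in>X. \<omega> (\<alpha> @ [x, y]) * g (label \<alpha> x y)))) = P * P - E"
    unfolding E by (simp add: inner sum.distrib sum_subtractf sum_distrib_right[symmetric] P_def[symmetric])
  also have "\<omega> \<alpha> * z None = - c1 * P / c0"
    using row_eq c_pos by (simp add: field_simps)
  also have "c1 * (- c1 * P / c0) * P + c2 * (P * P - E) = c2 * ((1 - c1\<^sup>2 / (c0 * c2)) * P\<^sup>2 - E)"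
    using c_pos by (simp add: field_simps power2_eq_square)
  finally have form_eq: "\<omega> \<alpha> * form 0 \<alpha> z z = c2 * ((1 - c1\<^sup>2 / (c0 * c2)) * P\<^sup>2 - E)" .
  have "(1 - c1\<^sup>2 / (c0 * c2)) * P\<^sup>2 \<le> E"
  proof (cases "c1\<^sup>2 \<ge> c0 * c2")
    case True
    then have "1 - c1\<^sup>2 / (c0 * c2) \<le> 0" using c_pos by (simp add: field_simps)
    then have "(1 - c1\<^sup>2 / (c0 * c2)) * P\<^sup>2 \<le> 0" by (intro mult_nonpos_nonneg) auto
    then show ?thesis using E_nonneg by linarith
  next
    case False
    have e_pos: "0 < e K" if "K \<in> par X L \<alpha>" for K
      using scalemon False that by (auto simp: ScaleMon_def Let_def e_def \<omega>_def c0_def c1_def c2_def)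
    have le1: "(1 - c1\<^sup>2 / (c0 * c2)) * (\<Sum>K\<in>par X L \<alpha>. 1 / e K) \<le> 1"
      using scalemon False by (auto simp: ScaleMon_def Let_def e_def \<omega>_def c0_def c1_def c2_def)
    have nonneg: "0 \<le> 1 - c1\<^sup>2 / (c0 * c2)" using False c_pos by (simp add: field_simps)
    \<comment> \<open>\<open>P\<close> is the sum of the class sums, so Cauchy-Schwarz with weights
      \<open>e K\<close> brings in exactly the sum of reciprocals from (ScaleMon).\<close>
    have "P\<^sup>2 \<le> (\<Sum>K\<in>par X L \<alpha>. 1 / e K) * E"
      unfolding P_def sum_par E_def by (rule weighted_Cauchy_Schwarz) (rule e_pos)
    then have "(1 - c1\<^sup>2 / (c0 * c2)) * P\<^sup>2 \<le> ((1 - c1\<^sup>2 / (c0 * c2)) * (\<Sum>K\<in>par X L \<alpha>. 1 / e K)) * E"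
      using nonneg unfolding mult.assoc by (rule mult_left_mono)
    also have "\<dots> \<le> 1 * E"
      using le1 E_nonneg by (rule mult_right_mono)
    finally show ?thesis by simp
  qed
  then have "\<omega> \<alpha> * form 0 \<alpha> z z \<le> 0"
    unfolding form_eq using c_pos by (simp add: mult_le_0_iff)
  then show ?thesis using \<omega>0 by (simp add: mult_le_0_iff)
qed

end

text \<open>The step for \<open>Suc j\<close> at \<open>\<alpha>\<close> uses index \<open>j\<close>
  at \<open>\<alpha>\<close> and at \<open>\<alpha> @ [x]\<close>, so
  \<open>length \<alpha> + j\<close> never grows and all words met are shorter than
  \<open>k\<close>.\<close>

lemma (in weighted_interval_greedoid) hyperbolic_form:
  assumes "k < greedoid_rk L"
    and c: "\<forall>i\<le>greedoid_rk L. 0 < c i"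
    and adm: "\<forall>\<alpha>\<in>L. length \<alpha> < k \<longrightarrow> ContInv X L q \<alpha> \<and> PAMon X L q \<alpha> \<and> LogMod X L (scaled L q c) \<alpha> \<and>
        FewDes X L \<alpha> \<and> SynMon X L (scaled L q c) \<alpha> \<and> ScaleMon X L (scaled L q c) c \<alpha>"
    and "\<alpha> \<in> L" "length \<alpha> + j < k"
  shows "hyperbolic (form j \<alpha>)"
  using assms(4,5)
proof (induction j arbitrary: \<alpha>)
  case 0
  have a: "ContInv X L q \<alpha>" "LogMod X L (scaled L q c) \<alpha>"
        "FewDes X L \<alpha>" "SynMon X L (scaled L q c) \<alpha>" "ScaleMon X L (scaled L q c) c \<alpha>"
    using adm 0 by auto
  have "0 < c (length \<alpha>)" "0 < c (length \<alpha> + 1)" "0 < c (length \<alpha> + 2)"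
    using c 0 assms(1) by auto
  then have "form 0 \<alpha> z z \<le> 0" if "row 0 \<alpha> z = 0" for z
    by (rule form_0_nonpos[where c = c]) (fact 0 a that)+
  then show ?case
    by (intro hyperbolicI[where l = "row 0 \<alpha>" and F = "form 0 \<alpha>"] row_add
        form_add_self[OF a(1)])
next
  case (Suc j)
  show ?case
  proof (rule hyperbolic_Suc)
    show "ContInv X L q (\<alpha> @ [x])" if "x \<in> C \<alpha>" for x
      using adm Suc.prems that by (simp add: mem_C)
    show "hyperbolic (form j (\<alpha> @ [x]))" if "x \<in> C \<alpha>" for x
      using Suc.prems that by (intro Suc.IH) (auto simp: mem_C)
  qed (use adm Suc assms(1) in auto)
qed

lemma (in weighted_greedoid) level_sum_eq: "level_sum L q j = B j []"
proof -
  have "cont_words X L j [] = {\<alpha> \<in> L. length \<alpha> = j}"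
    using L_words Nil_in_L by (auto simp: cont_words_def)
  then show ?thesis
    using sum_cont_words[of q "[]" j] by (auto simp: level_sum_def zero_ext_def intro: sum.cong)
qed

theorem theorem1p31:
  fixes X :: "'a set" and L :: "'a list set" and k :: nat and q :: "'a list \<Rightarrow> real"
  assumes "interval_greedoid X L"
    and "1 \<le> k" and "k < greedoid_rk L"
    and "\<forall>\<alpha>\<in>L. q \<alpha> > 0"
    and "k_admissible X L k q"
  shows "(level_sum L q k)\<^sup>2 \<ge> level_sum L q (k - 1) * level_sum L q (k + 1)"
proof -
  interpret interval_greedoid X L by fact
  interpret weighted_interval_greedoid X L q
    by unfold_locales (use assms(4) in auto)
  obtain j where k: "k = Suc j" using assms(2) by (cases k) auto
  obtain c where c: "\<forall>i\<le>greedoid_rk L. 0 < c i"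
    and adm: "\<forall>\<alpha>\<in>L. length \<alpha> < k \<longrightarrow> ContInv X L q \<alpha> \<and> PAMon X L q \<alpha> \<and> LogMod X L (scaled L q c) \<alpha> \<and>
        FewDes X L \<alpha> \<and> SynMon X L (scaled L q c) \<alpha> \<and> ScaleMon X L (scaled L q c) c \<alpha>"
    using assms(5) unfolding k_admissible_def by blast
  have hyp: "hyperbolic (form j [])"
    using Nil_in_L k by (intro hyperbolic_form[OF assms(3) c adm]) auto
  have inv: "ContInv X L q []"
    using adm Nil_in_L k by simp
  define y :: "'a option \<Rightarrow> real" where "y = case_option 1 (\<lambda>_. 0)"
  have row_y: "row i \<alpha> y = B i \<alpha>" for i \<alpha>
    by (simp add: row_def y_def)
  have yy: "form j [] y y = B j []"
    using row_y[of j "[]"] by (simp add: form_def) (simp add: y_def)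
  \<comment> \<open>Symmetry moves \<open>hvec 0\<close>, the indicator of the letters, to the
    right, where \<open>form_hvec\<close> evaluates it.\<close>
  have yx: "form j [] (hvec 0) y = B k []"
    unfolding form_commute[OF inv, of j "hvec 0" y] form_hvec row_y k by simp
  have xx: "form j [] (hvec 0) (hvec 0) = B (k + 1) []"
    unfolding form_hvec row_hvec k by simp
  have "0 < form j [] y y"
    unfolding yy using Nil_in_L assms(3) k by (intro B_pos) auto
  then have "form j [] (hvec 0) (hvec 0) * form j [] y y \<le> (form j [] (hvec 0) y)\<^sup>2"
    using hyp unfolding hyperbolic_def by blast
  then show ?thesis
    unfolding yy yx xx level_sum_eq k by (simp add: mult.commute)
qed

end
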